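(* Let $\Phi: X \to \{0,1\}$ be a Boolean function on a set $X$; elements with $\Phi(x)=1$ are called good and the others bad. Let $\delta < \epsilon$. Suppose $C$ is a quantum circuit that uses no measurement and decides $\Phi$ with two-sided exact error $(\delta,\epsilon)$: for every good $x \in X$ the probability of error is exactly $\epsilon$ and for every bad $x$ the probability of error is exactly $\delta$, where success and error are determined by measuring the output state of $C$ (run on the input $x$) with some fixed two-outcome projective measurement. Then there exists a quantum circuit $C'$ that calls $C$ and $C^\dagger$, uses the same input as $C$ (possibly together with additional ancilla qubits), is measured using an extension of the measurement operator of $C$ (i.e., the original measurement tensored with a measurement on the ancillae), and decides $\Phi$ with certainty.
   Context: The input $x$ may be supplied to $C$ either encoded in the initial state (as $\ket{x}$ together with ancillae in a fixed state) or through an oracle gate $U_x:\ket{y,b}\mapsto\ket{y, b\oplus \Phi(y)}$ for $b\in\{0,1\}$; the phrase "uses the same input as $C$" means $C'$ receives $x$ in the same way. A two-outcome projective measurement is a pair $\langle P_E, I-P_E\rangle$ with $P_E$ a projector.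
   Formalization: If "error" means the wrong answer (different outcomes on good and bad inputs), δ + ε ≠ 1 is also assumed: otherwise a circuit that ignores its input and accepts with probability δ meets the hypotheses for every Φ. If error is one fixed outcome, nothing is added. *)

theory Defs
  imports Complex_Main "Jordan_Normal_Form.Schur_Decomposition"
begin

text \<open>A register of \<open>k\<close> qubits is the space of complex vectors of dimension \<open>2 ^ k\<close>; basis states
  are numbered in binary, so the index of a product basis state is \<open>i * d + j\<close>, where \<open>d\<close> is the
  dimension of the right factor.\<close>

definition kron_vec :: "complex vec \<Rightarrow> complex vec \<Rightarrow> complex vec" where
  "kron_vec u v = vec (dim_vec u * dim_vec v)
     (\<lambda>i. u $ (i div dim_vec v) * v $ (i mod dim_vec v))"

definition kron_mat :: "complex mat \<Rightarrow> complex mat \<Rightarrow> complex mat" where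
  "kron_mat A B = mat (dim_row A * dim_row B) (dim_col A * dim_col B)
     (\<lambda>(i, j). A $$ (i div dim_row B, j div dim_col B) * B $$ (i mod dim_row B, j mod dim_col B))"

definition unitary_mat :: "nat \<Rightarrow> complex mat \<Rightarrow> bool" where
  "unitary_mat d U \<longleftrightarrow> U \<in> carrier_mat d d \<and> U * mat_adjoint U = 1\<^sub>m d \<and> mat_adjoint U * U = 1\<^sub>m d"

definition projector :: "nat \<Rightarrow> complex mat \<Rightarrow> bool" where
  "projector d P \<longleftrightarrow> P \<in> carrier_mat d d \<and> P * P = P \<and> mat_adjoint P = P"

definition state :: "nat \<Rightarrow> complex vec \<Rightarrow> bool" where
  "state d v \<longleftrightarrow> v \<in> carrier_vec d \<and> v \<bullet>c v = 1"

text \<open>The squared norm of the projected state.\<close>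

definition outcome_prob :: "complex mat \<Rightarrow> complex vec \<Rightarrow> real" where
  "outcome_prob P v = Re ((P *\<^sub>v v) \<bullet>c (P *\<^sub>v v))"

text \<open>The two outcomes of the measurement given by a projector \<open>P\<close> and its complement.\<close>

definition outcomes :: "nat \<Rightarrow> complex mat \<Rightarrow> complex mat set" where
  "outcomes d P = {P, 1\<^sub>m d - P}"

text \<open>How the input \<open>x\<close> reaches a circuit. \<open>Encoded m enc\<close>: the first \<open>m\<close> qubits start in the basis
  state numbered \<open>enc x\<close>. \<open>Oracle q f\<close>: the circuit may query the bit function \<open>f x\<close> of \<open>q\<close>-bit
  arguments, and the initial state does not depend on \<open>x\<close>.\<close>

datatype 'x input_model = Encoded nat "'x \<Rightarrow> nat" | Oracle nat "'x \<Rightarrow> nat \<Rightarrow> bool"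

text \<open>\<open>\<phi>\<close> is the fixed state of all qubits that do not carry the encoded input.\<close>

fun valid_input :: "nat \<Rightarrow> 'x set \<Rightarrow> 'x input_model \<Rightarrow> complex vec \<Rightarrow> bool" where
  "valid_input n X (Encoded m enc) \<phi> \<longleftrightarrow>
     m \<le> n \<and> inj_on enc X \<and> enc ` X \<subseteq> {..<2 ^ m} \<and> state (2 ^ (n - m)) \<phi>"
| "valid_input n X (Oracle q f) \<phi> \<longleftrightarrow> q + 1 \<le> n \<and> state (2 ^ n) \<phi>"

fun initial_state :: "'x input_model \<Rightarrow> complex vec \<Rightarrow> 'x \<Rightarrow> complex vec" where
  "initial_state (Encoded m enc) \<phi> x = kron_vec (unit_vec (2 ^ m) (enc x)) \<phi>"
| "initial_state (Oracle q f) \<phi> x = \<phi>"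

text \<open>The map sending the basis state \<open>y, b\<close> to \<open>y, b \<oplus> g y\<close>, with \<open>y, b\<close> numbered \<open>2 * y + b\<close>.\<close>

definition oracle_mat :: "nat \<Rightarrow> (nat \<Rightarrow> bool) \<Rightarrow> complex mat" where
  "oracle_mat q g = mat (2 ^ (q + 1)) (2 ^ (q + 1))
     (\<lambda>(i, j). if i div 2 = j div 2 \<and> i mod 2 = (j mod 2 + of_bool (g (j div 2))) mod 2
               then 1 else 0)"

text \<open>The circuit \<open>C\<close>: measurement-free, its gates are unitaries not depending on the input, and oracle
  queries if the input is supplied by an oracle. A query acts on the leading qubits; this is no
  restriction because the qubits may be permuted by the other gates.\<close>

datatype gate = Gate "complex mat" | Query

fun valid_gate :: "nat \<Rightarrow> 'x input_model \<Rightarrow> gate \<Rightarrow> bool" where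
  "valid_gate n s (Gate U) \<longleftrightarrow> unitary_mat (2 ^ n) U"
| "valid_gate n (Encoded m enc) Query \<longleftrightarrow> False"
| "valid_gate n (Oracle q f) Query \<longleftrightarrow> True"

fun gate_mat :: "nat \<Rightarrow> 'x input_model \<Rightarrow> 'x \<Rightarrow> gate \<Rightarrow> complex mat" where
  "gate_mat n s x (Gate U) = U"
| "gate_mat n (Oracle q f) x Query = kron_mat (oracle_mat q (f x)) (1\<^sub>m (2 ^ (n - (q + 1))))"
| "gate_mat n (Encoded m enc) x Query = 1\<^sub>m (2 ^ n)"

text \<open>The first matrix of the list is applied first.\<close>

fun compose_mats :: "nat \<Rightarrow> complex mat list \<Rightarrow> complex mat" where
  "compose_mats d [] = 1\<^sub>m d"
| "compose_mats d (A # As) = compose_mats d As * A"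

definition circuit_mat :: "nat \<Rightarrow> 'x input_model \<Rightarrow> gate list \<Rightarrow> 'x \<Rightarrow> complex mat" where
  "circuit_mat n s C x = compose_mats (2 ^ n) (map (gate_mat n s x) C)"

definition circuit_output :: "nat \<Rightarrow> 'x input_model \<Rightarrow> complex vec \<Rightarrow> gate list \<Rightarrow> 'x \<Rightarrow> complex vec" where
  "circuit_output n s \<phi> C x = circuit_mat n s C x *\<^sub>v initial_state s \<phi> x"

text \<open>The circuit \<open>C'\<close> works on the \<open>n\<close> qubits of \<open>C\<close> and \<open>a\<close> further ancillae. It has access to an
  oracle only by calling \<open>C\<close> and its adjoint, which act on the first \<open>n\<close> qubits.\<close>

datatype call_gate = Plain "complex mat" | Call | Call_adjoint

fun valid_call_gate :: "nat \<Rightarrow> call_gate \<Rightarrow> bool" where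
  "valid_call_gate k (Plain U) \<longleftrightarrow> unitary_mat (2 ^ k) U"
| "valid_call_gate k Call \<longleftrightarrow> True"
| "valid_call_gate k Call_adjoint \<longleftrightarrow> True"

fun call_gate_mat :: "nat \<Rightarrow> complex mat \<Rightarrow> call_gate \<Rightarrow> complex mat" where
  "call_gate_mat a V (Plain U) = U"
| "call_gate_mat a V Call = kron_mat V (1\<^sub>m (2 ^ a))"
| "call_gate_mat a V Call_adjoint = kron_mat (mat_adjoint V) (1\<^sub>m (2 ^ a))"

definition calling_output ::
  "nat \<Rightarrow> nat \<Rightarrow> 'x input_model \<Rightarrow> complex vec \<Rightarrow> gate list \<Rightarrow> call_gate list \<Rightarrow> 'x \<Rightarrow> complex vec" where
  "calling_output n a s \<phi> C C' x =
     compose_mats (2 ^ (n + a)) (map (call_gate_mat a (circuit_mat n s C x)) C') *\<^sub>v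
     kron_vec (initial_state s \<phi> x) (unit_vec (2 ^ a) 0)"

text \<open>\<open>Eg\<close> and \<open>Eb\<close> are the outcomes that count as an error on good and on bad inputs.\<close>

definition two_sided_exact_error ::
  "('x \<Rightarrow> complex vec) \<Rightarrow> 'x set \<Rightarrow> ('x \<Rightarrow> bool) \<Rightarrow> complex mat \<Rightarrow> complex mat \<Rightarrow> real \<Rightarrow> real \<Rightarrow> bool"
where
  "two_sided_exact_error out X \<Phi> Eg Eb \<delta> \<epsilon> \<longleftrightarrow>
     (\<forall>x\<in>X. \<Phi> x \<longrightarrow> outcome_prob Eg (out x) = \<epsilon>) \<and>
     (\<forall>x\<in>X. \<not> \<Phi> x \<longrightarrow> outcome_prob Eb (out x) = \<delta>)"

text \<open>\<open>A\<close> is the accepting outcome.\<close>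

definition decides_with_certainty ::
  "('x \<Rightarrow> complex vec) \<Rightarrow> 'x set \<Rightarrow> ('x \<Rightarrow> bool) \<Rightarrow> complex mat \<Rightarrow> bool" where
  "decides_with_certainty out X \<Phi> A \<longleftrightarrow>
     (\<forall>x\<in>X. outcome_prob A (out x) = (if \<Phi> x then 1 else 0))"

end

theory Submission
  imports Defs
begin

text \<open>
  Let \<open>w = V \<xi>\<close> be the output of the circuit and \<open>p\<close> the probability of the outcome \<open>R\<close>.
  Multiplying the range of \<open>R\<close> by a phase \<open>\<alpha>\<close> and then the ray of \<open>w\<close> by a phase \<open>\<beta>\<close> turns
  \<open>R w\<close> into \<open>(\<alpha> - (1 - \<beta>) (1 - (1 - \<alpha>) p)) R w\<close>; the second phase is \<open>V\<close> times a phase on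
  the initial state times the adjoint of \<open>V\<close>. Here \<open>p\<close> takes only two known values, one on good
  and one on bad inputs.

  Such a step preserves the probabilities \<open>0\<close> and \<open>1\<close>, and for \<open>q \<le> 3/4\<close> suitable phases
  annihilate \<open>q\<close> and no other nonzero probability. Hence the smaller of the two values can be
  made \<open>0\<close>; if both exceed \<open>3/4\<close>, pass to the complementary outcome first. With \<open>\<alpha> = \<beta> = -1\<close>
  the other value \<open>r\<close> becomes \<open>(3 - 4 r)\<^sup>2 r \<ge> 4 r\<close> as long as \<open>r \<le> 1/4\<close>. Once \<open>r \<ge> 1/4\<close>, the
  complementary outcome has the probabilities \<open>1 - r \<le> 3/4\<close> and \<open>1\<close>, and annihilating the
  former decides with certainty.

  The initial state depends on an encoded input, so a phase on it is not a fixed gate. The label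
  \<open>y\<close> of the initial state \<open>\<zeta>\<^sub>y\<close> is therefore written into ancillae: the projector onto the span
  of all \<open>\<zeta>\<^sub>y \<otimes> e\<^sub>y\<close> acts on \<open>u \<otimes> e\<^sub>y\<close> as the projector onto the ray of \<open>\<zeta>\<^sub>y\<close> acts on \<open>u\<close>. The
  states \<open>\<zeta>\<^sub>y\<close> are orthonormal, so a reflection can write the labels.
\<close>

subsection \<open>Adjoints\<close>

lemma dim_mat_adjoint [simp]:
  "dim_row (mat_adjoint A) = dim_col A" "dim_col (mat_adjoint A) = dim_row A"
  by (auto simp: mat_adjoint_def)

lemma mat_adjoint_carrier [simp]: "A \<in> carrier_mat nr nc \<Longrightarrow> mat_adjoint A \<in> carrier_mat nc nr"
  by (intro carrier_matI) auto

lemma index_mat_adjoint [simp]: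
  "i < dim_col A \<Longrightarrow> j < dim_row A \<Longrightarrow> mat_adjoint A $$ (i, j) = conjugate (A $$ (j, i))"
  by (simp add: mat_adjoint_def mat_of_rows_def)

lemma row_mat_adjoint [simp]: "i < dim_col A \<Longrightarrow> row (mat_adjoint A) i = conjugate (col A i)"
  by (intro eq_vecI) auto

lemma col_mat_adjoint [simp]: "j < dim_row A \<Longrightarrow> col (mat_adjoint A) j = conjugate (row A j)"
  by (intro eq_vecI) auto

lemma mat_adjoint_mat_adjoint [simp]: "mat_adjoint (mat_adjoint A) = A"
  by (rule eq_matI) auto

lemma conjugate_one [simp]: "conjugate 1 = (1 :: 'a::conjugatable_field)"
  using conjugate_dist_mul[of 1 "1 :: 'a"]
  by (metis conjugate_zero_iff mult.right_neutral mult_cancel_left one_neq_zero)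

lemma conjugate_diff: "conjugate (a - b) = conjugate a - conjugate (b :: 'a::conjugatable_ring)"
  using conjugate_dist_add[of a "- b"] by (simp add: conjugate_neg)

lemma conjugate_minus_vec:
  fixes u v :: "'a::conjugatable_ring vec"
  assumes "u \<in> carrier_vec d" "v \<in> carrier_vec d"
  shows "conjugate (u - v) = conjugate u - conjugate v"
  by (rule eq_vecI) (use assms in \<open>auto simp: conjugate_diff\<close>)

lemma conjugate_cscalar_prod:
  fixes u v :: "'a::conjugatable_field vec"
  assumes "u \<in> carrier_vec d" "v \<in> carrier_vec d"
  shows "conjugate (u \<bullet>c v) = v \<bullet>c u"
  using assms conjugate_sprod_vec[of u d "conjugate v"] comm_scalar_prod[of "conjugate u" d v]
  by simp

lemma mat_adjoint_one [simp]: "mat_adjoint (1\<^sub>m d) = 1\<^sub>m d"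
  by (rule eq_matI) auto

lemma mat_adjoint_smult: "mat_adjoint (k \<cdot>\<^sub>m A) = conjugate k \<cdot>\<^sub>m mat_adjoint A"
  by (rule eq_matI) (auto simp: conjugate_dist_mul)

lemma mat_adjoint_minus:
  assumes "A \<in> carrier_mat nr nc" "B \<in> carrier_mat nr nc"
  shows "mat_adjoint (A - B) = mat_adjoint A - mat_adjoint B"
  by (rule eq_matI) (use assms in \<open>auto simp: conjugate_diff\<close>)

lemma mat_adjoint_mult:
  assumes "A \<in> carrier_mat nr n" "B \<in> carrier_mat n nc"
  shows "mat_adjoint (A * B) = mat_adjoint B * mat_adjoint A"
proof (rule eq_matI)
  fix i j
  assume "i < dim_row (mat_adjoint B * mat_adjoint A)" "j < dim_col (mat_adjoint B * mat_adjoint A)"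
  then have ij: "i < nc" "j < nr" using assms by auto
  then have carrier: "row A j \<in> carrier_vec n" "col B i \<in> carrier_vec n" using assms by auto
  have "mat_adjoint (A * B) $$ (i, j) = conjugate (row A j \<bullet> col B i)"
    using assms ij by simp
  also have "\<dots> = conjugate (row A j) \<bullet> conjugate (col B i)"
    by (rule conjugate_sprod_vec[OF carrier])
  also have "\<dots> = conjugate (col B i) \<bullet> conjugate (row A j)"
    by (rule comm_scalar_prod[of _ n]) (use carrier in auto)
  also have "\<dots> = (mat_adjoint B * mat_adjoint A) $$ (i, j)"
    using assms ij by simp
  finally show "mat_adjoint (A * B) $$ (i, j) = (mat_adjoint B * mat_adjoint A) $$ (i, j)" .
qed (use assms in auto)

lemma mult_mat_vec_cscalar_prod:
  assumes A: "A \<in> carrier_mat nr nc" and u: "u \<in> carrier_vec nc" and v: "v \<in> carrier_vec nr"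
  shows "(A *\<^sub>v u) \<bullet>c v = u \<bullet>c (mat_adjoint A *\<^sub>v v)"
proof -
  have "transpose_mat A *\<^sub>v conjugate v = conjugate (mat_adjoint A *\<^sub>v v)"
    using A v by (intro eq_vecI) (auto simp: conjugate_conjugate_sprod[of _ nr])
  moreover have "(transpose_mat (transpose_mat A) *\<^sub>v u) \<bullet>c v
      = u \<bullet> (transpose_mat A *\<^sub>v conjugate v)"
    by (rule transpose_vec_mult_scalar) (use A u v in auto)
  ultimately show ?thesis by simp
qed

subsection \<open>Unitary matrices\<close>

lemma unitary_mat_carrier: "unitary_mat d U \<Longrightarrow> U \<in> carrier_mat d d"
  by (simp add: unitary_mat_def)

lemma unitary_matI:
  assumes "U \<in> carrier_mat d d" "mat_adjoint U * U = 1\<^sub>m d"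
  shows "unitary_mat d U"
  using assms mat_mult_left_right_inverse[of "mat_adjoint U" d U] by (simp add: unitary_mat_def)

lemma unitary_mat_adjoint: "unitary_mat d U \<Longrightarrow> unitary_mat d (mat_adjoint U)"
  by (simp add: unitary_mat_def)

lemma unitary_mat_one: "unitary_mat d (1\<^sub>m d)"
  by (simp add: unitary_mat_def)

lemma unitary_mat_mult:
  assumes U: "unitary_mat d U" and V: "unitary_mat d V"
  shows "unitary_mat d (U * V)"
proof (rule unitary_matI)
  note carrier = unitary_mat_carrier[OF U] unitary_mat_carrier[OF V]
  then show "U * V \<in> carrier_mat d d" by (rule mult_carrier_mat)
  have "mat_adjoint (U * V) * (U * V) = mat_adjoint V * (mat_adjoint U * U * V)"
    using carrier by (simp add: mat_adjoint_mult[OF carrier] assoc_mult_mat[of _ d d _ d _ d])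
  also have "\<dots> = 1\<^sub>m d" using U V carrier by (simp add: unitary_mat_def)
  finally show "mat_adjoint (U * V) * (U * V) = 1\<^sub>m d" .
qed

lemma unitary_mat_adjoint_cancel:
  assumes "unitary_mat d U" "v \<in> carrier_vec d"
  shows "mat_adjoint U *\<^sub>v (U *\<^sub>v v) = v" "U *\<^sub>v (mat_adjoint U *\<^sub>v v) = v"
  using assms assoc_mult_mat_vec[of "mat_adjoint U" d d U d v]
    assoc_mult_mat_vec[of U d d "mat_adjoint U" d v]
  by (auto simp: unitary_mat_def)

lemma state_unitary_mat:
  assumes U: "unitary_mat d U" and v: "state d v"
  shows "state d (U *\<^sub>v v)"
proof -
  have carrier: "U \<in> carrier_mat d d" "v \<in> carrier_vec d" "U *\<^sub>v v \<in> carrier_vec d"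
    using assms mult_mat_vec_carrier[OF unitary_mat_carrier]
    by (auto simp: unitary_mat_def state_def)
  then have "(U *\<^sub>v v) \<bullet>c (U *\<^sub>v v) = v \<bullet>c v"
    by (simp only: mult_mat_vec_cscalar_prod unitary_mat_adjoint_cancel[OF U])
  then show ?thesis using v carrier by (simp add: state_def)
qed

lemma unitary_permutation_mat:
  assumes inj: "inj_on \<sigma> {..<d}" and range: "\<And>j. j < d \<Longrightarrow> \<sigma> j < d"
  shows "unitary_mat d (mat d d (\<lambda>(i, j). of_bool (i = \<sigma> j)))" (is "unitary_mat d ?K")
proof (rule unitary_matI)
  have col: "vec d (\<lambda>i. of_bool (i = \<sigma> j)) = (unit_vec d (\<sigma> j) :: complex vec)" for j
    by (intro eq_vecI) (auto simp: unit_vec_def)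
  have conj: "conjugate (unit_vec d k :: complex vec) = unit_vec d k" for k
    by (intro eq_vecI) (auto simp: unit_vec_def)
  show "mat_adjoint ?K * ?K = 1\<^sub>m d"
  proof (rule eq_matI)
    fix i j assume "i < dim_row (1\<^sub>m d :: complex mat)" "j < dim_col (1\<^sub>m d :: complex mat)"
    then have ij: "i < d" "j < d" by auto
    have "(mat_adjoint ?K * ?K) $$ (i, j) = unit_vec d (\<sigma> i) \<bullet> unit_vec d (\<sigma> j)"
      using ij by (simp add: col conj)
    also have "\<dots> = of_bool (\<sigma> i = \<sigma> j)" using ij range by simp
    also have "\<dots> = 1\<^sub>m d $$ (i, j)" using ij inj by (auto dest: inj_onD)
    finally show "(mat_adjoint ?K * ?K) $$ (i, j) = 1\<^sub>m d $$ (i, j)" .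
  qed auto
qed simp

subsection \<open>Projectors and phases\<close>

lemma projector_carrier: "projector d P \<Longrightarrow> P \<in> carrier_mat d d"
  by (simp add: projector_def)

lemma projector_one: "projector d (1\<^sub>m d)"
  by (simp add: projector_def)

lemma projector_idem_vec: "projector d P \<Longrightarrow> v \<in> carrier_vec d \<Longrightarrow> P *\<^sub>v (P *\<^sub>v v) = P *\<^sub>v v"
  using assoc_mult_mat_vec[of P d d P d v] by (simp add: projector_def)

definition phase_mat :: "nat \<Rightarrow> complex \<Rightarrow> complex mat \<Rightarrow> complex mat" where
  "phase_mat d \<alpha> R = 1\<^sub>m d - (1 - \<alpha>) \<cdot>\<^sub>m R"

lemma phase_mat_carrier [simp]: "R \<in> carrier_mat d d \<Longrightarrow> phase_mat d \<alpha> R \<in> carrier_mat d d"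
  by (simp add: phase_mat_def minus_carrier_mat)

lemma phase_mat_mult_vec:
  assumes R: "R \<in> carrier_mat d d" and v: "v \<in> carrier_vec d"
  shows "phase_mat d \<alpha> R *\<^sub>v v = v - (1 - \<alpha>) \<cdot>\<^sub>v (R *\<^sub>v v)"
proof -
  have "((1 - \<alpha>) \<cdot>\<^sub>m R) *\<^sub>v v = (1 - \<alpha>) \<cdot>\<^sub>v (R *\<^sub>v v)"
    using assms by (intro eq_vecI) auto
  then show ?thesis
    using minus_mult_distrib_mat_vec[of "1\<^sub>m d" d d "(1 - \<alpha>) \<cdot>\<^sub>m R" v] assms
    by (simp add: phase_mat_def)
qed

lemma mat_adjoint_phase_mat:
  assumes "projector d R"
  shows "mat_adjoint (phase_mat d \<alpha> R) = phase_mat d (cnj \<alpha>) R"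
  using assms mat_adjoint_minus[of "1\<^sub>m d" d d "(1 - \<alpha>) \<cdot>\<^sub>m R"]
  by (simp add: phase_mat_def projector_def mat_adjoint_smult)

lemma phase_mat_mult_phase_mat:
  assumes "projector d R"
  shows "phase_mat d \<alpha> R * phase_mat d \<beta> R = phase_mat d (\<alpha> * \<beta>) R"
proof -
  have R: "R \<in> carrier_mat d d" and idem: "R * R = R" using assms by (auto simp: projector_def)
  have "phase_mat d \<alpha> R * phase_mat d \<beta> R
      = 1\<^sub>m d - (1 - \<alpha>) \<cdot>\<^sub>m R - (1 - \<beta>) \<cdot>\<^sub>m (R - (1 - \<alpha>) \<cdot>\<^sub>m R)"
    using R unfolding phase_mat_def
    by (simp add: mult_minus_distrib_mat[of _ d d _ d] minus_mult_distrib_mat[of _ d d _ _ d]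
        mult_smult_assoc_mat[of _ d d _ d] mult_smult_distrib[of _ d d _ d] minus_carrier_mat idem)
  also have "\<dots> = phase_mat d (\<alpha> * \<beta>) R"
    using R by (intro eq_matI) (auto simp: phase_mat_def algebra_simps)
  finally show ?thesis .
qed

lemma unitary_phase_mat:
  assumes R: "projector d R" and \<alpha>: "cmod \<alpha> = 1"
  shows "unitary_mat d (phase_mat d \<alpha> R)"
proof (rule unitary_matI)
  have "cnj \<alpha> * \<alpha> = 1" using complex_norm_square[of \<alpha>] \<alpha> by (simp add: mult.commute)
  then have "mat_adjoint (phase_mat d \<alpha> R) * phase_mat d \<alpha> R = phase_mat d 1 R"
    using R by (simp add: mat_adjoint_phase_mat phase_mat_mult_phase_mat)
  also have "\<dots> = 1\<^sub>m d"
    using projector_carrier[OF R] by (intro eq_matI) (auto simp: phase_mat_def)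
  finally show "mat_adjoint (phase_mat d \<alpha> R) * phase_mat d \<alpha> R = 1\<^sub>m d" .
qed (use projector_carrier[OF R] in simp)

lemma projector_complement:
  assumes P: "projector d P"
  shows "projector d (1\<^sub>m d - P)"
proof -
  have "1\<^sub>m d - P = phase_mat d 0 P"
    using projector_carrier[OF P] by (intro eq_matI) (auto simp: phase_mat_def)
  then show ?thesis
    using P by (simp add: projector_def[of d "phase_mat d 0 P"] phase_mat_mult_phase_mat
        mat_adjoint_phase_mat projector_carrier)
qed

lemma complement_complement_mat:
  "P \<in> carrier_mat d d \<Longrightarrow> 1\<^sub>m d - (1\<^sub>m d - P) = (P :: 'a::ring_1 mat)"
  by (intro eq_matI) auto

lemma outcome_prob_nonneg: "0 \<le> outcome_prob P v"
  using conjugate_square_ge_0_vec[of "P *\<^sub>v v"] by (simp add: outcome_prob_def less_eq_complex_def)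

lemma of_real_outcome_prob: "of_real (outcome_prob P v) = (P *\<^sub>v v) \<bullet>c (P *\<^sub>v v)"
  using conjugate_square_ge_0_vec[of "P *\<^sub>v v"]
  by (simp add: outcome_prob_def less_eq_complex_def complex_eq_iff)

lemma projector_cscalar_prod:
  assumes P: "projector d P" and v: "v \<in> carrier_vec d"
  shows "(P *\<^sub>v v) \<bullet>c v = of_real (outcome_prob P v)"
proof -
  have "(P *\<^sub>v (P *\<^sub>v v)) \<bullet>c v = (P *\<^sub>v v) \<bullet>c (P *\<^sub>v v)"
    using P v mult_mat_vec_carrier[OF projector_carrier[OF P] v]
    by (subst mult_mat_vec_cscalar_prod[of _ d d]) (auto simp: projector_def)
  then show ?thesis using P v by (simp add: projector_idem_vec of_real_outcome_prob)
qed

lemma outcome_prob_complement: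
  assumes P: "projector d P" and v: "state d v"
  shows "outcome_prob (1\<^sub>m d - P) v = 1 - outcome_prob P v"
proof -
  have carrier: "P \<in> carrier_mat d d" "v \<in> carrier_vec d"
    using assms by (auto simp: projector_def state_def)
  have "of_real (outcome_prob (1\<^sub>m d - P) v) = ((1\<^sub>m d - P) *\<^sub>v v) \<bullet>c v"
    using projector_cscalar_prod[OF projector_complement[OF P] carrier(2)] by simp
  also have "\<dots> = v \<bullet>c v - (P *\<^sub>v v) \<bullet>c v"
    using carrier
    by (simp add: minus_mult_distrib_mat_vec[of _ d d] minus_scalar_prod_distrib[of _ d])
  also have "\<dots> = of_real (1 - outcome_prob P v)"
    using projector_cscalar_prod[OF P carrier(2)] v by (simp add: state_def)
  finally show ?thesis by (simp only: of_real_eq_iff)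
qed

lemma outcome_prob_le_one: "projector d P \<Longrightarrow> state d v \<Longrightarrow> outcome_prob P v \<le> 1"
  using outcome_prob_complement[of d P v] outcome_prob_nonneg[of "1\<^sub>m d - P" v] by simp

lemma outcome_prob_smult:
  assumes "P *\<^sub>v u = c \<cdot>\<^sub>v (P *\<^sub>v v)"
  shows "outcome_prob P u = (cmod c)\<^sup>2 * outcome_prob P v"
proof -
  have "complex_of_real (outcome_prob P u) = of_real ((cmod c)\<^sup>2 * outcome_prob P v)"
    unfolding of_real_mult of_real_outcome_prob assms complex_norm_square
    by (simp add: conjugate_smult_vec mult_ac)
  then show ?thesis by (simp only: of_real_eq_iff)
qed

subsection \<open>Orthonormal families\<close>

definition orthonormal :: "nat \<Rightarrow> nat \<Rightarrow> (nat \<Rightarrow> complex vec) \<Rightarrow> bool" where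
  "orthonormal d m z \<longleftrightarrow> (\<forall>y<m. z y \<in> carrier_vec d) \<and>
     (\<forall>y<m. \<forall>y'<m. z y \<bullet>c z y' = of_bool (y = y'))"

lemma orthonormal_carrier: "orthonormal d m z \<Longrightarrow> y < m \<Longrightarrow> z y \<in> carrier_vec d"
  by (simp add: orthonormal_def)

lemma orthonormal_cscalar_prod:
  "orthonormal d m z \<Longrightarrow> y < m \<Longrightarrow> y' < m \<Longrightarrow> z y \<bullet>c z y' = of_bool (y = y')"
  by (simp add: orthonormal_def)

lemma orthonormal_state: "orthonormal d m z \<Longrightarrow> y < m \<Longrightarrow> state d (z y)"
  by (simp add: orthonormal_def state_def)

lemma orthonormal_singleton: "state d v \<Longrightarrow> orthonormal d 1 (\<lambda>_. v)"
  by (simp add: orthonormal_def state_def)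

definition frame_mat :: "nat \<Rightarrow> nat \<Rightarrow> (nat \<Rightarrow> complex vec) \<Rightarrow> complex mat" where
  "frame_mat d m z = mat_of_cols d (map z [0..<m])"

lemma frame_mat_carrier [simp]: "frame_mat d m z \<in> carrier_mat d m"
  using mat_of_cols_carrier(1)[of d "map z [0..<m]"] by (simp add: frame_mat_def)

lemma dim_frame_mat [simp]: "dim_row (frame_mat d m z) = d" "dim_col (frame_mat d m z) = m"
  by (simp_all add: frame_mat_def)

lemma col_frame_mat: "y < m \<Longrightarrow> z y \<in> carrier_vec d \<Longrightarrow> col (frame_mat d m z) y = z y"
  by (simp add: frame_mat_def)

lemma frame_mat_mult_unit_vec:
  assumes "y < m" "z y \<in> carrier_vec d"
  shows "frame_mat d m z *\<^sub>v unit_vec m y = z y"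
  using assms by (intro eq_vecI) (auto simp: frame_mat_def mat_of_cols_index)

lemma mat_adjoint_frame_mat_mult_vec:
  assumes z: "\<And>y. y < m \<Longrightarrow> z y \<in> carrier_vec d" and u: "u \<in> carrier_vec d"
  shows "mat_adjoint (frame_mat d m z) *\<^sub>v u = vec m (\<lambda>y. u \<bullet>c z y)"
  by (rule eq_vecI) (auto simp: col_frame_mat z conjugate_vec_sprod_comm[OF u z])

lemma gram_frame_mat:
  assumes z: "orthonormal d m z"
  shows "mat_adjoint (frame_mat d m z) * frame_mat d m z = 1\<^sub>m m"
proof (rule eq_matI)
  fix i j assume "i < dim_row (1\<^sub>m m :: complex mat)" "j < dim_col (1\<^sub>m m :: complex mat)"
  then have ij: "i < m" "j < m" by auto
  then have "(mat_adjoint (frame_mat d m z) * frame_mat d m z) $$ (i, j) = conjugate (z i) \<bullet> z j"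
    by (simp add: col_frame_mat orthonormal_carrier[OF z])
  also have "\<dots> = z j \<bullet>c z i"
    using ij by (intro conjugate_vec_sprod_comm[of _ d, symmetric] orthonormal_carrier[OF z])
  finally show "(mat_adjoint (frame_mat d m z) * frame_mat d m z) $$ (i, j) = 1\<^sub>m m $$ (i, j)"
    using ij by (auto simp: orthonormal_cscalar_prod[OF z])
qed auto

definition span_projector :: "nat \<Rightarrow> nat \<Rightarrow> (nat \<Rightarrow> complex vec) \<Rightarrow> complex mat" where
  "span_projector d m z = frame_mat d m z * mat_adjoint (frame_mat d m z)"

lemma projector_span_projector:
  assumes z: "orthonormal d m z"
  shows "projector d (span_projector d m z)"
proof -
  let ?Z = "frame_mat d m z"
  have "?Z * mat_adjoint ?Z * (?Z * mat_adjoint ?Z) = ?Z * (mat_adjoint ?Z * ?Z * mat_adjoint ?Z)"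
    by (simp add: assoc_mult_mat[of _ d m _ d _ d] assoc_mult_mat[of _ m d _ m _ d]
        mult_carrier_mat[of _ d m _ d])
  also have "\<dots> = ?Z * mat_adjoint ?Z" by (simp add: gram_frame_mat[OF z])
  finally show ?thesis
    by (simp add: projector_def span_projector_def mat_adjoint_mult[of _ d m _ d]
        mult_carrier_mat[of _ d m])
qed

lemma span_projector_mult_vec:
  assumes z: "orthonormal d m z" and u: "u \<in> carrier_vec d" and y: "y < m"
    and overlap: "\<And>y'. y' < m \<Longrightarrow> y' \<noteq> y \<Longrightarrow> u \<bullet>c z y' = 0"
  shows "span_projector d m z *\<^sub>v u = (u \<bullet>c z y) \<cdot>\<^sub>v z y"
proof -
  have "mat_adjoint (frame_mat d m z) *\<^sub>v u = (u \<bullet>c z y) \<cdot>\<^sub>v unit_vec m y"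
    using overlap
    by (auto simp: mat_adjoint_frame_mat_mult_vec[OF orthonormal_carrier[OF z] u] unit_vec_def)
  then show ?thesis
    using y orthonormal_carrier[OF z y] u
    by (simp add: span_projector_def assoc_mult_mat_vec[of _ d m _ d] mult_mat_vec[of _ d m]
        frame_mat_mult_unit_vec)
qed

lemma orthonormal_scaled_difference:
  assumes u: "orthonormal d m u" and v: "orthonormal d m v"
    and orth: "\<And>y y'. y < m \<Longrightarrow> y' < m \<Longrightarrow> u y \<bullet>c v y' = 0"
  shows "orthonormal d m (\<lambda>y. of_real (1 / sqrt 2) \<cdot>\<^sub>v (u y - v y))"
  unfolding orthonormal_def
proof (intro conjI allI impI)
  fix y y' assume y: "y < m" and y': "y' < m"
  note carrier = orthonormal_carrier[OF u y] orthonormal_carrier[OF u y']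
    orthonormal_carrier[OF v y] orthonormal_carrier[OF v y']
  have "v y \<bullet>c u y' = 0"
    using conjugate_cscalar_prod[OF carrier(2,3)] orth[OF y' y] by simp
  then have "(u y - v y) \<bullet>c (u y' - v y') = 2 * of_bool (y = y')"
    using carrier y y' orth[OF y y']
    by (simp add: conjugate_minus_vec minus_scalar_prod_distrib[of _ d]
        scalar_prod_minus_distrib[of _ d]
        orthonormal_cscalar_prod[OF u] orthonormal_cscalar_prod[OF v])
  moreover have "complex_of_real (1 / sqrt 2) * of_real (1 / sqrt 2) = 1 / 2"
    by (simp flip: of_real_mult)
  ultimately show "(of_real (1 / sqrt 2) \<cdot>\<^sub>v (u y - v y)) \<bullet>c
      (of_real (1 / sqrt 2) \<cdot>\<^sub>v (u y' - v y')) = of_bool (y = y')"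
    using carrier by (simp add: conjugate_smult_vec)
qed (use u v in \<open>auto simp: orthonormal_def\<close>)

definition swap_reflection ::
  "nat \<Rightarrow> nat \<Rightarrow> (nat \<Rightarrow> complex vec) \<Rightarrow> (nat \<Rightarrow> complex vec) \<Rightarrow> complex mat" where
  "swap_reflection d m u v =
     phase_mat d (- 1) (span_projector d m (\<lambda>y. of_real (1 / sqrt 2) \<cdot>\<^sub>v (u y - v y)))"

lemma unitary_swap_reflection:
  assumes "orthonormal d m u" "orthonormal d m v"
    and "\<And>y y'. y < m \<Longrightarrow> y' < m \<Longrightarrow> u y \<bullet>c v y' = 0"
  shows "unitary_mat d (swap_reflection d m u v)"
  unfolding swap_reflection_def
  using assms
  by (intro unitary_phase_mat projector_span_projector orthonormal_scaled_difference) auto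

lemma swap_reflection_mult_vec:
  assumes u: "orthonormal d m u" and v: "orthonormal d m v"
    and orth: "\<And>y y'. y < m \<Longrightarrow> y' < m \<Longrightarrow> u y \<bullet>c v y' = 0" and y: "y < m"
  shows "swap_reflection d m u v *\<^sub>v u y = v y"
proof -
  define c where "c = complex_of_real (1 / sqrt 2)"
  let ?z = "\<lambda>y. c \<cdot>\<^sub>v (u y - v y)"
  have swap: "swap_reflection d m u v = phase_mat d (- 1) (span_projector d m ?z)"
    by (simp only: swap_reflection_def c_def)
  have z: "orthonormal d m ?z"
    unfolding c_def using u v orth by (rule orthonormal_scaled_difference)
  note carrier = orthonormal_carrier[OF u] orthonormal_carrier[OF v]
  have overlap: "u y \<bullet>c ?z y' = c * of_bool (y = y')" if "y' < m" for y'
    using carrier[OF y] carrier[OF that] y that orth[OF y that]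
    by (simp add: c_def conjugate_smult_vec conjugate_minus_vec[of _ d]
        scalar_prod_minus_distrib[of _ d] orthonormal_cscalar_prod[OF u])
  have "span_projector d m ?z *\<^sub>v u y = (u y \<bullet>c ?z y) \<cdot>\<^sub>v ?z y"
    by (rule span_projector_mult_vec[OF z carrier(1)[OF y] y]) (simp add: overlap)
  then have "swap_reflection d m u v *\<^sub>v u y = u y - 2 \<cdot>\<^sub>v (c \<cdot>\<^sub>v (c \<cdot>\<^sub>v (u y - v y)))"
    using phase_mat_mult_vec[OF projector_carrier[OF projector_span_projector[OF z]]
        carrier(1)[OF y]]
    by (simp add: swap overlap[OF y])
  also have "2 \<cdot>\<^sub>v (c \<cdot>\<^sub>v (c \<cdot>\<^sub>v (u y - v y))) = u y - v y"
  proof -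
    have "2 * (c * c) = 1" by (simp add: c_def flip: of_real_mult)
    then show ?thesis by (simp add: smult_smult_assoc)
  qed
  also have "u y - (u y - v y) = v y" using carrier[OF y] by (intro eq_vecI) auto
  finally show ?thesis .
qed

subsection \<open>Tensor products\<close>

lemma less_mult_imp_mod_less: "i < d * e \<Longrightarrow> i mod e < (e :: nat)"
  by (cases "e = 0") auto

lemma sum_div_mod:
  fixes f :: "nat \<Rightarrow> nat \<Rightarrow> 'a::comm_monoid_add"
  shows "(\<Sum>i<d * e. f (i div e) (i mod e)) = (\<Sum>a<d. \<Sum>b<e. f a b)"
proof -
  have "(\<Sum>i = a * e..<a * e + e. f (i div e) (i mod e)) = (\<Sum>b<e. f a b)" for a
    using sum.shift_bounds_nat_ivl[of "\<lambda>i. f (i div e) (i mod e)" 0 "a * e" e]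
    by (simp add: atLeast0LessThan add.commute)
  then show ?thesis
    using sum.nat_group[of "\<lambda>i. f (i div e) (i mod e)" e d] by simp
qed

lemma dim_kron_vec [simp]: "dim_vec (kron_vec u v) = dim_vec u * dim_vec v"
  by (simp add: kron_vec_def)

lemma kron_vec_carrier [simp]:
  "u \<in> carrier_vec d \<Longrightarrow> v \<in> carrier_vec e \<Longrightarrow> kron_vec u v \<in> carrier_vec (d * e)"
  by (auto simp: kron_vec_def)

lemma index_kron_vec [simp]:
  "i < dim_vec u * dim_vec v \<Longrightarrow> kron_vec u v $ i = u $ (i div dim_vec v) * v $ (i mod dim_vec v)"
  by (simp add: kron_vec_def)

lemma kron_vec_scalar_prod:
  assumes "dim_vec u = dim_vec u'" "dim_vec v = dim_vec v'"
  shows "kron_vec u v \<bullet> kron_vec u' v' = (u \<bullet> u') * (v \<bullet> v')"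
proof -
  let ?e = "dim_vec v'"
  have "kron_vec u v \<bullet> kron_vec u' v' =
      (\<Sum>i<dim_vec u' * ?e. u $ (i div ?e) * v $ (i mod ?e) * (u' $ (i div ?e) * v' $ (i mod ?e)))"
    using assms by (simp add: scalar_prod_def atLeast0LessThan)
  also have "\<dots> = (\<Sum>a<dim_vec u'. \<Sum>b<?e. u $ a * v $ b * (u' $ a * v' $ b))"
    by (rule sum_div_mod)
  also have "\<dots> = (u \<bullet> u') * (v \<bullet> v')"
    by (simp add: scalar_prod_def atLeast0LessThan sum_product mult_ac)
  finally show ?thesis .
qed

lemma conjugate_kron_vec: "conjugate (kron_vec u v) = kron_vec (conjugate u) (conjugate v)"
  by (rule eq_vecI) (auto simp: less_mult_imp_div_less less_mult_imp_mod_less)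

lemma kron_vec_cscalar_prod:
  "dim_vec u = dim_vec u' \<Longrightarrow> dim_vec v = dim_vec v' \<Longrightarrow>
    kron_vec u v \<bullet>c kron_vec u' v' = (u \<bullet>c u') * (v \<bullet>c v')"
  by (simp add: conjugate_kron_vec kron_vec_scalar_prod)

lemma kron_vec_minus_left:
  "dim_vec u = dim_vec u' \<Longrightarrow> kron_vec (u - u') v = kron_vec u v - kron_vec u' v"
  by (rule eq_vecI) (auto simp: less_mult_imp_div_less less_mult_imp_mod_less algebra_simps)

lemma kron_vec_smult_left: "kron_vec (c \<cdot>\<^sub>v u) v = c \<cdot>\<^sub>v kron_vec u v"
  by (rule eq_vecI) (auto simp: less_mult_imp_div_less less_mult_imp_mod_less)

lemma orthonormal_unit_vec: "orthonormal d d (unit_vec d)"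
proof -
  have "conjugate (unit_vec d i :: complex vec) = unit_vec d i" for i
    by (intro eq_vecI) (auto simp: unit_vec_def)
  then show ?thesis by (simp add: orthonormal_def)
qed

lemma orthonormal_kron_vec:
  assumes "orthonormal d m z" "\<And>y. y < m \<Longrightarrow> state e (v y)"
  shows "orthonormal (d * e) m (\<lambda>y. kron_vec (z y) (v y))"
proof -
  have dims: "dim_vec (z y) = d" "dim_vec (v y) = e" if "y < m" for y
    using assms that by (auto simp: orthonormal_def state_def)
  then show ?thesis
    using assms by (auto simp: orthonormal_def state_def kron_vec_cscalar_prod dims)
qed

lemma dim_kron_mat [simp]:
  "dim_row (kron_mat A B) = dim_row A * dim_row B" "dim_col (kron_mat A B) = dim_col A * dim_col B"
  by (simp_all add: kron_mat_def)

lemma index_kron_mat [simp]: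
  "i < dim_row A * dim_row B \<Longrightarrow> j < dim_col A * dim_col B \<Longrightarrow> kron_mat A B $$ (i, j) =
    A $$ (i div dim_row B, j div dim_col B) * B $$ (i mod dim_row B, j mod dim_col B)"
  by (simp add: kron_mat_def)

lemma row_kron_mat:
  "i < dim_row A * dim_row B \<Longrightarrow>
    row (kron_mat A B) i = kron_vec (row A (i div dim_row B)) (row B (i mod dim_row B))"
  by (rule eq_vecI) (auto simp: less_mult_imp_div_less less_mult_imp_mod_less)

lemma col_kron_mat:
  "j < dim_col A * dim_col B \<Longrightarrow>
    col (kron_mat A B) j = kron_vec (col A (j div dim_col B)) (col B (j mod dim_col B))"
  by (rule eq_vecI) (auto simp: less_mult_imp_div_less less_mult_imp_mod_less)

lemma kron_mat_mult_kron_vec: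
  "dim_col A = dim_vec u \<Longrightarrow> dim_col B = dim_vec v \<Longrightarrow>
    kron_mat A B *\<^sub>v kron_vec u v = kron_vec (A *\<^sub>v u) (B *\<^sub>v v)"
  by (rule eq_vecI)
    (auto simp: row_kron_mat kron_vec_scalar_prod less_mult_imp_div_less less_mult_imp_mod_less)

lemma kron_mat_one_mult_kron_vec:
  "A \<in> carrier_mat nr nc \<Longrightarrow> u \<in> carrier_vec nc \<Longrightarrow> v \<in> carrier_vec e \<Longrightarrow>
    kron_mat A (1\<^sub>m e) *\<^sub>v kron_vec u v = kron_vec (A *\<^sub>v u) v"
  by (simp add: kron_mat_mult_kron_vec)

lemma kron_mat_mult_kron_mat:
  "dim_col A = dim_row A' \<Longrightarrow> dim_col B = dim_row B' \<Longrightarrow>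
    kron_mat A B * kron_mat A' B' = kron_mat (A * A') (B * B')"
  by (rule eq_matI)
    (auto simp: row_kron_mat col_kron_mat kron_vec_scalar_prod
      less_mult_imp_div_less less_mult_imp_mod_less)

lemma mat_adjoint_kron_mat: "mat_adjoint (kron_mat A B) = kron_mat (mat_adjoint A) (mat_adjoint B)"
  by (rule eq_matI) (auto simp: less_mult_imp_div_less less_mult_imp_mod_less)

lemma kron_mat_one_one: "kron_mat (1\<^sub>m d) (1\<^sub>m e) = 1\<^sub>m (d * e)"
proof (rule eq_matI)
  fix i j
  assume "i < dim_row (1\<^sub>m (d * e) :: complex mat)" "j < dim_col (1\<^sub>m (d * e) :: complex mat)"
  moreover have "i = j" if "i div e = j div e" "i mod e = j mod e"
    using that by (metis div_mult_mod_eq)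
  ultimately show "kron_mat (1\<^sub>m d) (1\<^sub>m e) $$ (i, j) = 1\<^sub>m (d * e) $$ (i, j)"
    by (auto simp: less_mult_imp_div_less less_mult_imp_mod_less)
qed auto

lemma kron_mat_minus_left:
  "dim_row A = dim_row A' \<Longrightarrow> dim_col A = dim_col A' \<Longrightarrow>
    kron_mat (A - A') B = kron_mat A B - kron_mat A' B"
  by (rule eq_matI) (auto simp: less_mult_imp_div_less less_mult_imp_mod_less algebra_simps)

lemma unitary_kron_mat:
  assumes "unitary_mat d A" "unitary_mat e B"
  shows "unitary_mat (d * e) (kron_mat A B)"
  using assms
  by (auto simp: unitary_mat_def kron_mat_mult_kron_mat mat_adjoint_kron_mat kron_mat_one_one)

lemma projector_kron_mat:
  assumes "projector d A" "projector e B"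
  shows "projector (d * e) (kron_mat A B)"
  using assms by (auto simp: projector_def kron_mat_mult_kron_mat mat_adjoint_kron_mat)

lemma outcome_prob_kron_mat_one:
  assumes "P \<in> carrier_mat d d" "u \<in> carrier_vec d" "state e v"
  shows "outcome_prob (kron_mat P (1\<^sub>m e)) (kron_vec u v) = outcome_prob P u"
  using assms
  by (auto simp: outcome_prob_def state_def kron_mat_one_mult_kron_vec[of _ d d]
      kron_vec_cscalar_prod)

lemma outcomes_kron_mat_one:
  assumes "P \<in> carrier_mat d d" "E \<in> outcomes d P"
  shows "kron_mat E (1\<^sub>m e) \<in> outcomes (d * e) (kron_mat P (1\<^sub>m e))"
  using assms by (auto simp: outcomes_def kron_mat_minus_left kron_mat_one_one)

subsection \<open>Circuits\<close>

lemma compose_mats_carrier: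
  "\<forall>A\<in>set As. A \<in> carrier_mat d d \<Longrightarrow> compose_mats d As \<in> carrier_mat d d"
  by (induction As) auto

lemma compose_mats_append:
  assumes "\<forall>A\<in>set (As @ Bs). A \<in> carrier_mat d d"
  shows "compose_mats d (As @ Bs) = compose_mats d Bs * compose_mats d As"
  using assms
proof (induction As)
  case Nil
  then show ?case using compose_mats_carrier[of Bs d] by simp
next
  case (Cons A As)
  then show ?case
    using compose_mats_carrier[of As d] compose_mats_carrier[of Bs d]
    by (simp add: assoc_mult_mat[of _ d d _ d _ d])
qed

lemma mat_adjoint_compose_mats:
  assumes "\<forall>A\<in>set As. A \<in> carrier_mat d d"
  shows "mat_adjoint (compose_mats d As) = compose_mats d (rev (map mat_adjoint As))"
  using assms
proof (induction As)
  case (Cons A As)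
  then have "mat_adjoint (compose_mats d (A # As))
      = mat_adjoint A * mat_adjoint (compose_mats d As)"
    using compose_mats_carrier[of As d] by (simp add: mat_adjoint_mult[of _ d d _ d])
  also have "\<dots> = compose_mats d (rev (map mat_adjoint (A # As)))"
    using Cons by (auto simp: compose_mats_append)
  finally show ?case .
qed simp

lemma unitary_compose_mats: "\<forall>A\<in>set As. unitary_mat d A \<Longrightarrow> unitary_mat d (compose_mats d As)"
  by (induction As) (auto intro: unitary_mat_one unitary_mat_mult)

lemma unitary_oracle_mat: "unitary_mat (2 ^ (q + 1)) (oracle_mat q g)"
proof -
  define \<sigma> where "\<sigma> j = 2 * (j div 2) + (j mod 2 + of_bool (g (j div 2))) mod 2" for j
  have div: "\<sigma> j div 2 = j div 2"
    and mod: "\<sigma> j mod 2 = (j mod 2 + of_bool (g (j div 2))) mod 2" for j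
    by (simp_all add: \<sigma>_def)
  have "inj \<sigma>"
  proof (rule injI)
    fix i j assume eq: "\<sigma> i = \<sigma> j"
    have div_eq: "i div 2 = j div 2" using div[of i] div[of j] eq by simp
    have "(i mod 2 + of_bool (g (j div 2))) mod 2 = (j mod 2 + of_bool (g (j div 2))) mod 2"
      using mod[of i] mod[of j] eq by (simp only: div_eq)
    then have "i mod 2 = j mod 2" by (auto simp: mod2_eq_if split: if_splits)
    with div_eq show "i = j" by (metis div_mult_mod_eq)
  qed
  moreover have "\<sigma> j < 2 ^ (q + 1)" if "j < 2 ^ (q + 1)" for j
  proof -
    have "\<sigma> j div 2 < 2 ^ q" using that by (auto simp: div)
    then show ?thesis by auto
  qed
  moreover have "oracle_mat q g = mat (2 ^ (q + 1)) (2 ^ (q + 1)) (\<lambda>(i, j). of_bool (i = \<sigma> j))"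
  proof -
    have "i = \<sigma> j \<longleftrightarrow> i div 2 = j div 2 \<and> i mod 2 = (j mod 2 + of_bool (g (j div 2))) mod 2" for i j
      using div mod by (metis div_mult_mod_eq)
    then show ?thesis by (intro eq_matI) (auto simp: oracle_mat_def)
  qed
  ultimately show ?thesis
    using unitary_permutation_mat[of \<sigma> "2 ^ (q + 1)"] by (metis inj_on_subset subset_UNIV)
qed

lemma unitary_gate_mat:
  assumes "valid_input n X s \<phi>" "valid_gate n s g"
  shows "unitary_mat (2 ^ n) (gate_mat n s x g)"
proof (cases g)
  case Query
  then obtain q f where s: "s = Oracle q f" using assms(2) by (cases s) auto
  then have "(2 :: nat) ^ (q + 1) * 2 ^ (n - (q + 1)) = 2 ^ n"
    using assms(1) by (subst power_add[symmetric]) simp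
  then show ?thesis
    using unitary_kron_mat[OF unitary_oracle_mat[of q "f x"], of "2 ^ (n - (q + 1))" "1\<^sub>m _"]
    using Query s unitary_mat_one
    by (simp del: power_Suc)
qed (use assms(2) in auto)

lemma unitary_circuit_mat:
  assumes "valid_input n X s \<phi>" "\<forall>g\<in>set C. valid_gate n s g"
  shows "unitary_mat (2 ^ n) (circuit_mat n s C x)"
  unfolding circuit_mat_def using assms
  by (intro unitary_compose_mats) (auto intro: unitary_gate_mat)

lemma labelled_initial_states:
  assumes "valid_input n X s \<phi>"
  obtains k \<zeta> label where "orthonormal (2 ^ n) (2 ^ k) \<zeta>" "\<And>x. label x < 2 ^ k"
    "\<And>x. x \<in> X \<Longrightarrow> initial_state s \<phi> x = \<zeta> (label x)"
proof (cases s)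
  case (Encoded m enc)
  then have m: "m \<le> n" and enc: "\<And>x. x \<in> X \<Longrightarrow> enc x < 2 ^ m" and \<phi>: "state (2 ^ (n - m)) \<phi>"
    using assms by auto
  have "orthonormal (2 ^ n) (2 ^ m) (\<lambda>y. kron_vec (unit_vec (2 ^ m) y) \<phi>)"
    using orthonormal_kron_vec[OF orthonormal_unit_vec \<phi>, of "2 ^ m"] m
    by (simp flip: power_add)
  then show ?thesis
    by (rule that[of _ _ "\<lambda>x. if x \<in> X then enc x else 0"]) (use enc Encoded in auto)
next
  case (Oracle q f)
  then have "orthonormal (2 ^ n) (2 ^ 0) (\<lambda>_. \<phi>)"
    using assms orthonormal_singleton[of "2 ^ n" \<phi>] by simp
  then show ?thesis by (rule that[of _ _ "\<lambda>_. 0"]) (use Oracle in auto)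
qed

lemma two_sided_error_outcome_probs:
  assumes less: "\<delta> < \<epsilon>" and P: "projector d P"
    and outcomes: "Eg \<in> outcomes d P" "Eb \<in> outcomes d P"
    and out: "\<forall>x\<in>X. state d (out x)"
    and error: "two_sided_exact_error out X \<Phi> Eg Eb \<delta> \<epsilon>"
    and nondegenerate: "Eg \<noteq> Eb \<longrightarrow> \<delta> + \<epsilon> \<noteq> 1"
  obtains p q where "p \<noteq> q" "p \<in> {0..1}" "q \<in> {0..1}"
    "\<forall>x\<in>X. outcome_prob P (out x) = (if \<Phi> x then p else q)"
proof -
  define p q where "p = (if Eg = P then \<epsilon> else 1 - \<epsilon>)" and "q = (if Eb = P then \<delta> else 1 - \<delta>)"
  have "p \<noteq> q"
    using less outcomes nondegenerate by (auto simp: p_def q_def outcomes_def)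
  have prob: "outcome_prob P (out x) = (if \<Phi> x then p else q)" if "x \<in> X" for x
    using error outcomes that outcome_prob_complement[OF P out[rule_format, OF that]]
    by (auto simp: two_sided_exact_error_def outcomes_def p_def q_def)
  have range: "outcome_prob P (out x) \<in> {0..1}" if "x \<in> X" for x
    using outcome_prob_nonneg outcome_prob_le_one[OF P out[rule_format, OF that]] by simp
  show ?thesis
  proof (cases "\<exists>b. \<forall>x\<in>X. \<Phi> x = b")
    \<comment> \<open>One of \<open>\<delta>\<close> and \<open>\<epsilon>\<close> is then unconstrained and need not be a probability.\<close>
    case True
    then obtain b where b: "\<And>x. x \<in> X \<Longrightarrow> \<Phi> x = b" by blast
    obtain r where r: "r \<in> {0..1}" "\<And>x. x \<in> X \<Longrightarrow> outcome_prob P (out x) = r"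
      using prob range b by (cases "X = {}") (auto, force)
    define r' :: real where "r' = (if r = 0 then 1 else 0)"
    show ?thesis
      by (rule that[of "if b then r else r'" "if b then r' else r"])
        (use b r in \<open>auto simp: r'_def\<close>)
  next
    case False
    then obtain x y where "x \<in> X" "\<Phi> x" "y \<in> X" "\<not> \<Phi> y" by blast
    then have "p \<in> {0..1}" "q \<in> {0..1}" using prob range by (metis (full_types))+
    with \<open>p \<noteq> q\<close> show ?thesis using prob by (intro that[of p q]) auto
  qed
qed

subsection \<open>One amplification step\<close>

definition ray_projector :: "nat \<Rightarrow> complex vec \<Rightarrow> complex mat" where
  "ray_projector d v = span_projector d 1 (\<lambda>_. v)"

lemma projector_ray_projector: "state d v \<Longrightarrow> projector d (ray_projector d v)"
  unfolding ray_projector_def by (intro projector_span_projector orthonormal_singleton)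

lemma ray_projector_mult_vec:
  "state d v \<Longrightarrow> u \<in> carrier_vec d \<Longrightarrow> ray_projector d v *\<^sub>v u = (u \<bullet>c v) \<cdot>\<^sub>v v"
  unfolding ray_projector_def by (rule span_projector_mult_vec[OF orthonormal_singleton]) auto

lemma phase_ray_mult_vec:
  assumes "state d v" "u \<in> carrier_vec d"
  shows "phase_mat d \<beta> (ray_projector d v) *\<^sub>v u = u - ((1 - \<beta>) * (u \<bullet>c v)) \<cdot>\<^sub>v v"
  using assms phase_mat_mult_vec[OF projector_carrier[OF projector_ray_projector]]
  by (simp add: ray_projector_mult_vec smult_smult_assoc)

lemma conjugated_phase_ray_mult_vec:
  assumes W: "unitary_mat d W" and s: "state d s" and v: "v \<in> carrier_vec d"
  shows "W *\<^sub>v (phase_mat d \<beta> (ray_projector d s) *\<^sub>v (mat_adjoint W *\<^sub>v v))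
    = phase_mat d \<beta> (ray_projector d (W *\<^sub>v s)) *\<^sub>v v"
proof -
  note carrier = unitary_mat_carrier[OF W] unitary_mat_carrier[OF unitary_mat_adjoint[OF W]]
  have s': "s \<in> carrier_vec d" using s by (simp add: state_def)
  have v': "mat_adjoint W *\<^sub>v v \<in> carrier_vec d" using carrier(2) v by (rule mult_mat_vec_carrier)
  have "(mat_adjoint W *\<^sub>v v) \<bullet>c s = v \<bullet>c (W *\<^sub>v s)"
    using mult_mat_vec_cscalar_prod[OF carrier(2) v s'] by simp
  then show ?thesis
    using s s' v v' carrier(1) state_unitary_mat[OF W s] unitary_mat_adjoint_cancel(2)[OF W v]
    by (simp add: phase_ray_mult_vec mult_minus_distrib_mat_vec[of _ d d] mult_mat_vec[of _ d d])
qed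

definition amplified_prob :: "complex \<Rightarrow> complex \<Rightarrow> real \<Rightarrow> real" where
  "amplified_prob \<alpha> \<beta> p = (cmod (\<alpha> - (1 - \<beta>) * (1 - (1 - \<alpha>) * of_real p)))\<^sup>2 * p"

lemma outcome_prob_phase_ray_phase:
  assumes R: "projector d R" and w: "state d w"
  shows "outcome_prob R (phase_mat d \<beta> (ray_projector d w) *\<^sub>v (phase_mat d \<alpha> R *\<^sub>v w))
    = amplified_prob \<alpha> \<beta> (outcome_prob R w)"
proof -
  define v t where "v = phase_mat d \<alpha> R *\<^sub>v w" and "t = 1 - (1 - \<alpha>) * of_real (outcome_prob R w)"
  have carrier: "R \<in> carrier_mat d d" "w \<in> carrier_vec d" "R *\<^sub>v w \<in> carrier_vec d"
    using mult_mat_vec_carrier[OF projector_carrier[OF R]] R w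
    by (auto simp: projector_def state_def)
  have v: "v = w - (1 - \<alpha>) \<cdot>\<^sub>v (R *\<^sub>v w)" "v \<in> carrier_vec d"
    using carrier by (simp_all add: v_def phase_mat_mult_vec)
  have "v \<bullet>c w = t"
    using carrier w projector_cscalar_prod[OF R]
    by (simp add: v t_def minus_scalar_prod_distrib[of _ d] state_def)
  then have "R *\<^sub>v (phase_mat d \<beta> (ray_projector d w) *\<^sub>v v)
      = R *\<^sub>v v - ((1 - \<beta>) * t) \<cdot>\<^sub>v (R *\<^sub>v w)"
    using carrier v(2) w
    by (simp add: phase_ray_mult_vec mult_minus_distrib_mat_vec[of _ d d] mult_mat_vec[of _ d d])
  also have "R *\<^sub>v v = R *\<^sub>v w - (1 - \<alpha>) \<cdot>\<^sub>v (R *\<^sub>v w)"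
    using carrier R
    by (simp add: v(1) mult_minus_distrib_mat_vec[of _ d d] mult_mat_vec[of _ d d]
        projector_idem_vec)
  also have "\<dots> - ((1 - \<beta>) * t) \<cdot>\<^sub>v (R *\<^sub>v w) = (\<alpha> - (1 - \<beta>) * t) \<cdot>\<^sub>v (R *\<^sub>v w)"
    using carrier by (intro eq_vecI) (auto simp: algebra_simps)
  finally show ?thesis
    using outcome_prob_smult by (simp add: amplified_prob_def t_def v_def)
qed

definition amplify ::
  "nat \<Rightarrow> complex mat \<Rightarrow> complex vec \<Rightarrow> complex \<Rightarrow> complex \<Rightarrow> complex mat \<Rightarrow> complex mat" where
  "amplify d R s \<alpha> \<beta> W =
     W * phase_mat d \<beta> (ray_projector d s) * mat_adjoint W * phase_mat d \<alpha> R * W"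

lemma outcome_prob_amplify:
  assumes R: "projector d R" and W: "unitary_mat d W" and s: "state d s"
  shows "outcome_prob R (amplify d R s \<alpha> \<beta> W *\<^sub>v s) = amplified_prob \<alpha> \<beta> (outcome_prob R (W *\<^sub>v s))"
proof -
  have carrier: "W \<in> carrier_mat d d" "R \<in> carrier_mat d d" "ray_projector d s \<in> carrier_mat d d"
    "s \<in> carrier_vec d" "phase_mat d \<alpha> R *\<^sub>v (W *\<^sub>v s) \<in> carrier_vec d"
    using W R s projector_carrier[OF projector_ray_projector[OF s]]
    by (auto simp: unitary_mat_def projector_def state_def intro!: mult_mat_vec_carrier[of _ d d])
  have "amplify d R s \<alpha> \<beta> W *\<^sub>v s
      = W *\<^sub>v (phase_mat d \<beta> (ray_projector d s) *\<^sub>v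
          (mat_adjoint W *\<^sub>v (phase_mat d \<alpha> R *\<^sub>v (W *\<^sub>v s))))"
    using carrier
    by (simp add: amplify_def assoc_mult_mat_vec[of _ d d _ d] mult_carrier_mat[of _ d d _ d]
        mult_mat_vec_carrier[of _ d d])
  also have "\<dots> = phase_mat d \<beta> (ray_projector d (W *\<^sub>v s)) *\<^sub>v (phase_mat d \<alpha> R *\<^sub>v (W *\<^sub>v s))"
    by (rule conjugated_phase_ray_mult_vec[OF W s carrier(5)])
  finally show ?thesis
    using outcome_prob_phase_ray_phase[OF R state_unitary_mat[OF W s]] by simp
qed

subsection \<open>Choice of the phases\<close>

lemma amplified_prob_1:
  assumes "cmod \<alpha> = 1" "cmod \<beta> = 1"
  shows "amplified_prob \<alpha> \<beta> 1 = 1"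
proof -
  have "\<alpha> - (1 - \<beta>) * (1 - (1 - \<alpha>) * of_real 1) = \<alpha> * \<beta>" by (simp add: algebra_simps)
  then show ?thesis using assms by (simp add: amplified_prob_def norm_mult)
qed

lemma amplified_prob_minus_one: "amplified_prob (- 1) (- 1) p = (3 - 4 * p)\<^sup>2 * p"
proof -
  have "- 1 - (1 - - 1) * (1 - (1 - - 1) * complex_of_real p) = - of_real (3 - 4 * p)" by simp
  then show ?thesis by (simp only: amplified_prob_def norm_minus_cancel norm_of_real power2_abs)
qed

lemma unit_complex_with_Re:
  assumes "\<bar>c\<bar> \<le> 1"
  obtains \<alpha> where "cmod \<alpha> = 1" "Re \<alpha> = c"
proof -
  have "c\<^sup>2 \<le> 1" using assms by (simp add: abs_square_le_1)
  then show ?thesis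
    by (intro that[of "Complex c (sqrt (1 - c\<^sup>2))"]) (auto simp: cmod_def)
qed

lemma phase_solving_Re_half:
  assumes "Re t = 1 / 2"
  obtains \<beta> where "cmod \<beta> = 1" "(1 - \<beta>) * t = 1"
proof -
  have t: "t \<noteq> 0" using assms by auto
  have "cmod (t - 1) = cmod t" using assms by (simp add: cmod_def power2_eq_square field_simps)
  then have "cmod ((t - 1) / t) = 1" using t by (simp add: norm_divide)
  then show ?thesis using t by (intro that[of "(t - 1) / t"]) (auto simp: field_simps)
qed

lemma annihilating_phases:
  fixes q :: real
  assumes q: "q \<le> 3 / 4"
  obtains \<alpha> \<beta> where "cmod \<alpha> = 1" "cmod \<beta> = 1" "amplified_prob \<alpha> \<beta> q = 0"
    "\<And>p. 0 < p \<Longrightarrow> p \<noteq> q \<Longrightarrow> 0 < amplified_prob \<alpha> \<beta> p"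
proof -
  have "\<bar>(1 / 2 - q) / (1 - q)\<bar> \<le> 1" using q by (auto simp: abs_le_iff field_simps)
  then obtain \<alpha> where \<alpha>: "cmod \<alpha> = 1" "Re \<alpha> = (1 / 2 - q) / (1 - q)" by (rule unit_complex_with_Re)
  \<comment> \<open>\<open>(1 - \<beta>) t = 1\<close> has a solution with \<open>|\<beta>| = 1\<close> iff \<open>Re t = 1/2\<close>, which dictates \<open>Re \<alpha>\<close>.\<close>
  define t where "t = of_real q + of_real (1 - q) * cnj \<alpha>"
  have Re_t: "Re t = 1 / 2" using q \<alpha> by (simp add: t_def)
  then obtain \<beta> where \<beta>: "cmod \<beta> = 1" "(1 - \<beta>) * t = 1" by (rule phase_solving_Re_half)
  have "\<alpha> * cnj \<alpha> = 1" using complex_norm_square[of \<alpha>] \<alpha> by simp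
  then have "\<alpha> * t = 1 - (1 - \<alpha>) * of_real q"
    by (simp add: t_def algebra_simps)
  then have "(1 - \<beta>) * (1 - (1 - \<alpha>) * of_real q) = \<alpha>"
    using \<beta>(2) by (metis mult.left_commute mult.right_neutral)
  then have factor: "\<alpha> - (1 - \<beta>) * (1 - (1 - \<alpha>) * of_real p)
      = (1 - \<beta>) * (1 - \<alpha>) * of_real (p - q)" for p
    by (simp add: algebra_simps)
  have "\<beta> \<noteq> 1" "\<alpha> \<noteq> 1" using \<beta>(2) Re_t by (auto simp: t_def)
  then show ?thesis
    by (intro that[OF \<alpha>(1) \<beta>(1)]) (auto simp: amplified_prob_def factor)
qed

subsection \<open>Circuits calling a circuit and its adjoint\<close>

fun adjoint_call_gate :: "call_gate \<Rightarrow> call_gate" where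
  "adjoint_call_gate (Plain U) = Plain (mat_adjoint U)"
| "adjoint_call_gate Call = Call_adjoint"
| "adjoint_call_gate Call_adjoint = Call"

lemma valid_adjoint_call_gate: "valid_call_gate k g \<Longrightarrow> valid_call_gate k (adjoint_call_gate g)"
  by (cases g) (auto intro: unitary_mat_adjoint)

lemma call_gate_mat_adjoint:
  "call_gate_mat a V (adjoint_call_gate g) = mat_adjoint (call_gate_mat a V g)"
  by (cases g) (simp_all add: mat_adjoint_kron_mat)

definition adjoint_circuit :: "call_gate list \<Rightarrow> call_gate list" where
  "adjoint_circuit L = rev (map adjoint_call_gate L)"

locale calling_circuits =
  fixes n a m :: nat and X :: "'x set" and V :: "'x \<Rightarrow> complex mat"
    and \<zeta> :: "nat \<Rightarrow> complex vec" and label :: "'x \<Rightarrow> nat"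
  assumes unitary_V: "unitary_mat (2 ^ n) (V x)"
    and orthonormal_\<zeta>: "orthonormal (2 ^ n) m \<zeta>"
    and m_less: "m < 2 ^ a"
    and label_less: "label x < m"
begin

abbreviation input_state :: "'x \<Rightarrow> complex vec" where
  "input_state x \<equiv> \<zeta> (label x)"

text \<open>The ancilla state \<open>0\<close> is kept for inputs whose label has not been written yet.\<close>

abbreviation label_state :: "'x \<Rightarrow> complex vec" where
  "label_state x \<equiv> unit_vec (2 ^ a) (Suc (label x))"

abbreviation start_state :: "'x \<Rightarrow> complex vec" where
  "start_state x \<equiv> kron_vec (input_state x) (unit_vec (2 ^ a) 0)"

abbreviation complement :: "complex mat \<Rightarrow> complex mat" where
  "complement R \<equiv> 1\<^sub>m (2 ^ n) - R"

abbreviation valid :: "call_gate list \<Rightarrow> bool" where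
  "valid L \<equiv> \<forall>g\<in>set L. valid_call_gate (n + a) g"

definition run :: "call_gate list \<Rightarrow> 'x \<Rightarrow> complex mat" where
  "run L x = compose_mats (2 ^ (n + a)) (map (call_gate_mat a (V x)) L)"

lemma state_input_state: "state (2 ^ n) (input_state x)"
  using orthonormal_\<zeta> label_less by (rule orthonormal_state)

lemma kron_vec_label_carrier:
  "u \<in> carrier_vec (2 ^ n) \<Longrightarrow> kron_vec u (label_state x) \<in> carrier_vec (2 ^ (n + a))"
  using kron_vec_carrier[of u "2 ^ n" "label_state x" "2 ^ a"] by (simp add: power_add)

lemma unitary_call_gate_mat:
  assumes "valid_call_gate (n + a) g"
  shows "unitary_mat (2 ^ (n + a)) (call_gate_mat a (V x) g)"
  using assms unitary_V[of x] unitary_mat_one[of "2 ^ a"]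
  by (cases g) (auto simp: power_add intro: unitary_kron_mat unitary_mat_adjoint)

lemma unitary_run: "valid L \<Longrightarrow> unitary_mat (2 ^ (n + a)) (run L x)"
  unfolding run_def by (intro unitary_compose_mats) (auto intro: unitary_call_gate_mat)

lemma run_append:
  assumes "valid L" "valid L'"
  shows "run (L @ L') x = run L' x * run L x"
  unfolding run_def map_append
  using assms by (intro compose_mats_append) (auto intro: unitary_mat_carrier unitary_call_gate_mat)

lemma run_singleton: "valid_call_gate (n + a) g \<Longrightarrow> run [g] x = call_gate_mat a (V x) g"
  by (simp add: run_def left_mult_one_mat[OF unitary_mat_carrier[OF unitary_call_gate_mat]])

lemma run_append_mult_vec:
  assumes "valid L" "valid L'" "v \<in> carrier_vec (2 ^ (n + a))"
  shows "run (L @ L') x *\<^sub>v v = run L' x *\<^sub>v (run L x *\<^sub>v v)"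
  using assms unitary_mat_carrier[OF unitary_run]
  by (simp add: run_append
      assoc_mult_mat_vec[OF unitary_mat_carrier unitary_mat_carrier, OF unitary_run unitary_run])

lemma run_adjoint_circuit:
  assumes "valid L"
  shows "run (adjoint_circuit L) x = mat_adjoint (run L x)"
proof -
  have "\<forall>A\<in>set (map (call_gate_mat a (V x)) L). A \<in> carrier_mat (2 ^ (n + a)) (2 ^ (n + a))"
    using assms by (auto intro: unitary_mat_carrier unitary_call_gate_mat)
  then show ?thesis
    by (simp add: run_def adjoint_circuit_def mat_adjoint_compose_mats rev_map
        call_gate_mat_adjoint comp_def)
qed

definition realizes :: "call_gate list \<Rightarrow> ('x \<Rightarrow> complex mat) \<Rightarrow> bool" where
  "realizes L W \<longleftrightarrow> valid L \<and> (\<forall>x. unitary_mat (2 ^ n) (W x) \<and>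
     (\<forall>u\<in>carrier_vec (2 ^ n).
        run L x *\<^sub>v kron_vec u (label_state x) = kron_vec (W x *\<^sub>v u) (label_state x)))"

lemma realizes_valid: "realizes L W \<Longrightarrow> valid L"
  by (simp add: realizes_def)

lemma realizes_unitary: "realizes L W \<Longrightarrow> unitary_mat (2 ^ n) (W x)"
  by (simp add: realizes_def)

lemma realizes_run:
  "realizes L W \<Longrightarrow> u \<in> carrier_vec (2 ^ n) \<Longrightarrow>
    run L x *\<^sub>v kron_vec u (label_state x) = kron_vec (W x *\<^sub>v u) (label_state x)"
  by (simp add: realizes_def)

lemma realizes_append:
  assumes L: "realizes L W" and L': "realizes L' W'"
  shows "realizes (L @ L') (\<lambda>x. W' x * W x)"
  unfolding realizes_def
proof (intro conjI allI ballI)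
  show "valid_call_gate (n + a) g" if "g \<in> set (L @ L')" for g
    using that realizes_valid[OF L] realizes_valid[OF L'] by auto
next
  fix x
  show "unitary_mat (2 ^ n) (W' x * W x)"
    by (intro unitary_mat_mult realizes_unitary[OF L] realizes_unitary[OF L'])
  fix u :: "complex vec" assume u: "u \<in> carrier_vec (2 ^ n)"
  note carrier = unitary_mat_carrier[OF realizes_unitary[OF L]]
    unitary_mat_carrier[OF realizes_unitary[OF L']]
  have "run (L @ L') x *\<^sub>v kron_vec u (label_state x)
      = run L' x *\<^sub>v (run L x *\<^sub>v kron_vec u (label_state x))"
    using realizes_valid[OF L] realizes_valid[OF L'] kron_vec_label_carrier[OF u]
    by (rule run_append_mult_vec)
  also have "\<dots> = kron_vec (W' x *\<^sub>v (W x *\<^sub>v u)) (label_state x)"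
    by (simp add: realizes_run[OF L u] realizes_run[OF L' mult_mat_vec_carrier[OF carrier(1) u]])
  also have "W' x *\<^sub>v (W x *\<^sub>v u) = W' x * W x *\<^sub>v u"
    by (rule assoc_mult_mat_vec[OF carrier(2,1) u, symmetric])
  finally show "run (L @ L') x *\<^sub>v kron_vec u (label_state x)
      = kron_vec (W' x * W x *\<^sub>v u) (label_state x)" .
qed

lemma realizes_adjoint_circuit:
  assumes L: "realizes L W"
  shows "realizes (adjoint_circuit L) (\<lambda>x. mat_adjoint (W x))"
  unfolding realizes_def
proof (intro conjI allI ballI)
  show "valid_call_gate (n + a) g" if "g \<in> set (adjoint_circuit L)" for g
    using that realizes_valid[OF L]
    by (auto simp: adjoint_circuit_def intro: valid_adjoint_call_gate)
next
  fix x
  have W: "unitary_mat (2 ^ n) (W x)" by (rule realizes_unitary[OF L])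
  then show adj: "unitary_mat (2 ^ n) (mat_adjoint (W x))" by (rule unitary_mat_adjoint)
  fix u :: "complex vec" assume u: "u \<in> carrier_vec (2 ^ n)"
  have Wu: "mat_adjoint (W x) *\<^sub>v u \<in> carrier_vec (2 ^ n)"
    by (rule mult_mat_vec_carrier[OF unitary_mat_carrier[OF adj] u])
  have "kron_vec u (label_state x) = run L x *\<^sub>v kron_vec (mat_adjoint (W x) *\<^sub>v u) (label_state x)"
    by (simp add: realizes_run[OF L Wu] unitary_mat_adjoint_cancel[OF W u])
  then show "run (adjoint_circuit L) x *\<^sub>v kron_vec u (label_state x)
      = kron_vec (mat_adjoint (W x) *\<^sub>v u) (label_state x)"
    using realizes_valid[OF L] kron_vec_label_carrier[OF Wu]
    by (simp add: run_adjoint_circuit unitary_mat_adjoint_cancel[OF unitary_run])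
qed

lemma realizes_singletonI:
  assumes "valid_call_gate (n + a) g" "\<And>x. unitary_mat (2 ^ n) (W x)"
    and "\<And>x u. u \<in> carrier_vec (2 ^ n) \<Longrightarrow>
      call_gate_mat a (V x) g *\<^sub>v kron_vec u (label_state x) = kron_vec (W x *\<^sub>v u) (label_state x)"
  shows "realizes [g] W"
  using assms by (simp add: realizes_def run_singleton)

lemma realizes_Call: "realizes [Call] V"
  by (intro realizes_singletonI unitary_V)
    (simp_all add: kron_mat_one_mult_kron_vec[OF unitary_mat_carrier[OF unitary_V]])

lemma realizes_Plain_phase:
  assumes T: "projector (2 ^ (n + a)) T" and \<alpha>: "cmod \<alpha> = 1"
    and S: "\<And>x. projector (2 ^ n) (S x)"
    and T_kron_vec: "\<And>x u. u \<in> carrier_vec (2 ^ n) \<Longrightarrow>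
      T *\<^sub>v kron_vec u (label_state x) = kron_vec (S x *\<^sub>v u) (label_state x)"
  shows "realizes [Plain (phase_mat (2 ^ (n + a)) \<alpha> T)] (\<lambda>x. phase_mat (2 ^ n) \<alpha> (S x))"
proof (rule realizes_singletonI)
  fix x and u :: "complex vec" assume u: "u \<in> carrier_vec (2 ^ n)"
  note S_carrier = projector_carrier[OF S, of x]
  have "phase_mat (2 ^ (n + a)) \<alpha> T *\<^sub>v kron_vec u (label_state x)
      = kron_vec u (label_state x) - (1 - \<alpha>) \<cdot>\<^sub>v kron_vec (S x *\<^sub>v u) (label_state x)"
    using phase_mat_mult_vec[OF projector_carrier[OF T] kron_vec_label_carrier[OF u]]
    by (simp add: T_kron_vec[OF u])
  also have "\<dots> = kron_vec (phase_mat (2 ^ n) \<alpha> (S x) *\<^sub>v u) (label_state x)"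
    by (simp add: phase_mat_mult_vec[OF S_carrier u] kron_vec_minus_left kron_vec_smult_left
        carrier_vecD[OF u] carrier_matD[OF S_carrier])
  finally show "call_gate_mat a (V x) (Plain (phase_mat (2 ^ (n + a)) \<alpha> T)) *\<^sub>v
      kron_vec u (label_state x) = kron_vec (phase_mat (2 ^ n) \<alpha> (S x) *\<^sub>v u) (label_state x)"
    by simp
qed (use T \<alpha> S in \<open>auto intro: unitary_phase_mat\<close>)


subsection \<open>Reading the input from its label\<close>

lemma orthonormal_labelled:
  assumes "\<And>y. y < m \<Longrightarrow> l y < 2 ^ a"
  shows "orthonormal (2 ^ (n + a)) m (\<lambda>y. kron_vec (\<zeta> y) (unit_vec (2 ^ a) (l y)))"
  using orthonormal_kron_vec[OF orthonormal_\<zeta>, of "2 ^ a" "\<lambda>y. unit_vec (2 ^ a) (l y)"] assms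
  by (simp add: power_add orthonormal_state[OF orthonormal_unit_vec])

definition label_projector :: "complex mat" where
  "label_projector = span_projector (2 ^ (n + a)) m (\<lambda>y. kron_vec (\<zeta> y) (unit_vec (2 ^ a) (Suc y)))"

lemma projector_label_projector: "projector (2 ^ (n + a)) label_projector"
  unfolding label_projector_def using m_less
  by (intro projector_span_projector orthonormal_labelled) simp

lemma label_projector_mult_vec:
  assumes u: "u \<in> carrier_vec (2 ^ n)"
  shows "label_projector *\<^sub>v kron_vec u (label_state x)
    = kron_vec (ray_projector (2 ^ n) (input_state x) *\<^sub>v u) (label_state x)"
proof -
  let ?z = "\<lambda>y. kron_vec (\<zeta> y) (unit_vec (2 ^ a) (Suc y))"
  have overlap: "kron_vec u (label_state x) \<bullet>c ?z y = (u \<bullet>c \<zeta> y) * of_bool (label x = y)"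
    if "y < m" for y
    using u orthonormal_carrier[OF orthonormal_\<zeta> that] m_less that label_less[of x]
    by (simp add: kron_vec_cscalar_prod orthonormal_cscalar_prod[OF orthonormal_unit_vec])
  have "label_projector *\<^sub>v kron_vec u (label_state x)
      = (kron_vec u (label_state x) \<bullet>c ?z (label x)) \<cdot>\<^sub>v ?z (label x)"
    unfolding label_projector_def
    using m_less label_less
    by (intro span_projector_mult_vec[OF orthonormal_labelled kron_vec_label_carrier[OF u]])
      (auto simp: overlap)
  also have "\<dots> = kron_vec ((u \<bullet>c input_state x) \<cdot>\<^sub>v input_state x) (label_state x)"
    by (simp add: overlap[OF label_less] kron_vec_smult_left)
  finally show ?thesis by (simp add: ray_projector_mult_vec[OF state_input_state u])
qed

definition copy_label :: "complex mat" where
  "copy_label = swap_reflection (2 ^ (n + a)) m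
     (\<lambda>y. kron_vec (\<zeta> y) (unit_vec (2 ^ a) 0)) (\<lambda>y. kron_vec (\<zeta> y) (unit_vec (2 ^ a) (Suc y)))"

lemma unlabelled_cscalar_prod_labelled:
  assumes "y < m" "y' < m"
  shows "kron_vec (\<zeta> y) (unit_vec (2 ^ a) 0) \<bullet>c kron_vec (\<zeta> y') (unit_vec (2 ^ a) (Suc y')) = 0"
  using m_less assms orthonormal_carrier[OF orthonormal_\<zeta>, of y]
    orthonormal_carrier[OF orthonormal_\<zeta>, of y']
  by (simp add: kron_vec_cscalar_prod orthonormal_cscalar_prod[OF orthonormal_unit_vec])

lemma unitary_copy_label: "unitary_mat (2 ^ (n + a)) copy_label"
  unfolding copy_label_def using m_less
  by (intro unitary_swap_reflection orthonormal_labelled unlabelled_cscalar_prod_labelled) auto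

lemma copy_label_mult_vec:
  "copy_label *\<^sub>v start_state x = kron_vec (input_state x) (label_state x)"
  unfolding copy_label_def using m_less label_less
  by (intro swap_reflection_mult_vec[where y = "label x"] orthonormal_labelled
      unlabelled_cscalar_prod_labelled) auto

definition amplify_circuit ::
  "complex mat \<Rightarrow> complex \<Rightarrow> complex \<Rightarrow> call_gate list \<Rightarrow> call_gate list" where
  "amplify_circuit R \<alpha> \<beta> L =
     L @ [Plain (phase_mat (2 ^ (n + a)) \<alpha> (kron_mat R (1\<^sub>m (2 ^ a))))] @ adjoint_circuit L @
     [Plain (phase_mat (2 ^ (n + a)) \<beta> label_projector)] @ L"

lemma realizes_amplify_circuit:
  assumes R: "projector (2 ^ n) R" and L: "realizes L W" and "cmod \<alpha> = 1" "cmod \<beta> = 1"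
  shows "realizes (amplify_circuit R \<alpha> \<beta> L) (\<lambda>x. amplify (2 ^ n) R (input_state x) \<alpha> \<beta> (W x))"
proof -
  have "realizes [Plain (phase_mat (2 ^ (n + a)) \<alpha> (kron_mat R (1\<^sub>m (2 ^ a))))]
      (\<lambda>_. phase_mat (2 ^ n) \<alpha> R)"
    using projector_kron_mat[OF R projector_one[of "2 ^ a"]] R assms(3)
    by (intro realizes_Plain_phase)
      (auto simp: power_add kron_mat_one_mult_kron_vec[OF projector_carrier])
  moreover have "realizes [Plain (phase_mat (2 ^ (n + a)) \<beta> label_projector)]
      (\<lambda>x. phase_mat (2 ^ n) \<beta> (ray_projector (2 ^ n) (input_state x)))"
    using assms(4) by (intro realizes_Plain_phase projector_label_projector
        projector_ray_projector state_input_state label_projector_mult_vec)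
  ultimately show ?thesis
    unfolding amplify_circuit_def amplify_def
    by (intro realizes_append realizes_adjoint_circuit L)
qed

subsection \<open>Attainable outcome probabilities\<close>

definition attains :: "complex mat \<Rightarrow> ('x \<Rightarrow> bool) \<Rightarrow> real \<Rightarrow> real \<Rightarrow> bool" where
  "attains R \<Psi> p q \<longleftrightarrow> (\<exists>L W. realizes L W \<and>
     (\<forall>x\<in>X. outcome_prob R (W x *\<^sub>v input_state x) = (if \<Psi> x then p else q)))"

lemma attains_V:
  assumes "\<forall>x\<in>X. outcome_prob R (V x *\<^sub>v input_state x) = (if \<Psi> x then p else q)"
  shows "attains R \<Psi> p q"
  unfolding attains_def using assms realizes_Call by blast

lemma attains_swap: "attains R (\<lambda>x. \<not> \<Psi> x) q p \<longleftrightarrow> attains R \<Psi> p q"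
proof -
  have "(if \<not> \<Psi> x then q else p) = (if \<Psi> x then p else q)" for x by simp
  then show ?thesis by (simp only: attains_def)
qed

lemma attains_complementI:
  assumes R: "projector (2 ^ n) R" and "attains R \<Psi> p q"
  shows "attains (complement R) \<Psi> (1 - p) (1 - q)"
proof -
  obtain L W where L: "realizes L W"
    and prob: "\<forall>x\<in>X. outcome_prob R (W x *\<^sub>v input_state x) = (if \<Psi> x then p else q)"
    using assms(2) by (auto simp: attains_def)
  have "\<forall>x\<in>X. outcome_prob (complement R) (W x *\<^sub>v input_state x) = (if \<Psi> x then 1 - p else 1 - q)"
    using prob
      outcome_prob_complement[OF R state_unitary_mat[OF realizes_unitary[OF L] state_input_state]]
    by simp
  with L show ?thesis unfolding attains_def by blast
qed

lemma attains_complement_iff: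
  assumes R: "projector (2 ^ n) R"
  shows "attains (complement R) \<Psi> (1 - p) (1 - q) \<longleftrightarrow> attains R \<Psi> p q"
  using attains_complementI[OF R]
    attains_complementI[OF projector_complement[OF R], of \<Psi> "1 - p" "1 - q"]
  by (auto simp: complement_complement_mat[OF projector_carrier[OF R]])

lemma attains_amplify:
  assumes R: "projector (2 ^ n) R" and "attains R \<Psi> p q" and phases: "cmod \<alpha> = 1" "cmod \<beta> = 1"
  shows "attains R \<Psi> (amplified_prob \<alpha> \<beta> p) (amplified_prob \<alpha> \<beta> q)"
proof -
  obtain L W where L: "realizes L W"
    and prob: "\<forall>x\<in>X. outcome_prob R (W x *\<^sub>v input_state x) = (if \<Psi> x then p else q)"
    using assms(2) by (auto simp: attains_def)
  have "\<forall>x\<in>X. outcome_prob R (amplify (2 ^ n) R (input_state x) \<alpha> \<beta> (W x) *\<^sub>v input_state x)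
      = (if \<Psi> x then amplified_prob \<alpha> \<beta> p else amplified_prob \<alpha> \<beta> q)"
    using prob by (simp add: outcome_prob_amplify[OF R realizes_unitary[OF L] state_input_state])
  with realizes_amplify_circuit[OF R L phases] show ?thesis unfolding attains_def by blast
qed

lemma attains_annihilate:
  assumes R: "projector (2 ^ n) R" and attained: "attains R \<Psi> p q"
    and q: "q \<le> 3 / 4" and p: "0 < p" "p \<noteq> q"
  obtains r where "0 < r" "p = 1 \<longrightarrow> r = 1" "attains R \<Psi> r 0"
proof -
  obtain \<alpha> \<beta> where phases: "cmod \<alpha> = 1" "cmod \<beta> = 1" "amplified_prob \<alpha> \<beta> q = 0"
    "\<And>p. 0 < p \<Longrightarrow> p \<noteq> q \<Longrightarrow> 0 < amplified_prob \<alpha> \<beta> p"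
    using annihilating_phases[OF q] by metis
  show ?thesis
  proof (rule that)
    show "attains R \<Psi> (amplified_prob \<alpha> \<beta> p) 0"
      using attains_amplify[OF R attained phases(1,2)] phases(3) by simp
  qed (use phases p amplified_prob_1 in auto)
qed

lemma attains_at_least_quarter:
  assumes R: "projector (2 ^ n) R" and "attains R \<Psi> r 0" "0 < r" "1 \<le> 4 ^ k * r"
  shows "\<exists>r'\<ge>1 / 4. attains R \<Psi> r' 0"
  using assms(2-)
proof (induction k arbitrary: r)
  case 0
  then show ?case by (intro exI[of _ r]) auto
next
  case (Suc k)
  show ?case
  proof (cases "1 / 4 \<le> r")
    case False
    let ?r = "(3 - 4 * r)\<^sup>2 * r"
    have "4 \<le> (3 - 4 * r)\<^sup>2" using power_mono[of 2 "3 - 4 * r" 2] False by simp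
    then have grow: "4 * r \<le> ?r" using Suc.prems(2) by (intro mult_right_mono) auto
    have "attains R \<Psi> ?r 0"
      using attains_amplify[OF R Suc.prems(1), of "- 1" "- 1"]
      by (simp add: amplified_prob_minus_one)
    moreover have "0 < ?r" using grow Suc.prems(2) by linarith
    moreover have "1 \<le> 4 ^ k * ?r"
    proof -
      have "1 \<le> 4 ^ k * (4 * r)" using Suc.prems(3) by simp
      also have "\<dots> \<le> 4 ^ k * ?r" using grow by (rule mult_left_mono) simp
      finally show ?thesis .
    qed
    ultimately show ?thesis by (rule Suc.IH)
  qed (use Suc.prems in auto)
qed

lemma attains_1_0_if_le:
  assumes R: "projector (2 ^ n) R" and attained: "attains R \<Psi> p q" and "q \<le> 3 / 4" "0 < p" "p \<noteq> q"
  shows "attains R \<Psi> 1 0"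
proof -
  obtain r where r: "0 < r" "attains R \<Psi> r 0"
    by (rule attains_annihilate[OF assms])
  obtain k where "1 / r < 4 ^ k" using real_arch_pow[of 4 "1 / r"] by auto
  then have "1 \<le> 4 ^ k * r" using r(1) by (simp add: field_simps)
  then obtain r' where r': "1 / 4 \<le> r'" "attains R \<Psi> r' 0"
    using attains_at_least_quarter[OF R r(2,1)] by blast
  have "attains (complement R) (\<lambda>x. \<not> \<Psi> x) 1 (1 - r')"
    using r'(2) attains_complementI[OF R, of \<Psi> r' 0] by (simp add: attains_swap)
  then obtain t where "(1 :: real) = 1 \<longrightarrow> t = 1" "attains (complement R) (\<lambda>x. \<not> \<Psi> x) t 0"
    by (rule attains_annihilate[OF projector_complement[OF R]]) (use r'(1) in auto)
  then show ?thesis using attains_complement_iff[OF R, of \<Psi> 1 0] by (simp add: attains_swap)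
qed

lemma attains_1_0_if_less:
  assumes R: "projector (2 ^ n) R" and attained: "attains R \<Psi> p q"
    and bounds: "0 \<le> q" "q < p" "p \<le> 1"
  shows "attains R \<Psi> 1 0"
proof (cases "q \<le> 3 / 4")
  case True
  with bounds show ?thesis by (intro attains_1_0_if_le[OF R attained]) auto
next
  case False
  have "attains (complement R) (\<lambda>x. \<not> \<Psi> x) (1 - q) (1 - p)"
    using attained by (simp add: attains_swap attains_complement_iff[OF R])
  then have "attains (complement R) (\<lambda>x. \<not> \<Psi> x) 1 0"
    by (rule attains_1_0_if_le[OF projector_complement[OF R]]) (use bounds False in auto)
  then show ?thesis using attains_complement_iff[OF R, of \<Psi> 1 0] by (simp add: attains_swap)
qed

lemma outcome_attains_1_0:
  assumes P: "projector (2 ^ n) P" and attained: "attains P \<Psi> p q"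
    and "p \<noteq> q" "p \<in> {0..1}" "q \<in> {0..1}"
  obtains E where "E \<in> outcomes (2 ^ n) P" "attains E \<Psi> 1 0"
proof (cases "q < p")
  case True
  then have "attains P \<Psi> 1 0" by (intro attains_1_0_if_less[OF P attained]) (use assms in auto)
  then show ?thesis by (intro that[of P]) (auto simp: outcomes_def)
next
  case False
  have "attains (complement P) \<Psi> (1 - p) (1 - q)" by (rule attains_complementI[OF P attained])
  then have "attains (complement P) \<Psi> 1 0"
    by (rule attains_1_0_if_less[OF projector_complement[OF P]]) (use False assms in auto)
  then show ?thesis by (intro that[of "complement P"]) (auto simp: outcomes_def)
qed

lemma realizes_Call_Call_adjoint_append:
  assumes L: "realizes L W"
  shows "realizes ([Call, Call_adjoint] @ L) W"
proof -
  have "W x * mat_adjoint (V x) * V x = W x" for x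
    using unitary_mat_carrier[OF realizes_unitary[OF L], of x] unitary_V[of x]
    by (simp add: assoc_mult_mat[of _ "2 ^ n" "2 ^ n" _ "2 ^ n" _ "2 ^ n"] unitary_mat_def)
  moreover have "realizes ([Call] @ adjoint_circuit [Call] @ L) (\<lambda>x. W x * mat_adjoint (V x) * V x)"
    by (intro realizes_append realizes_adjoint_circuit realizes_Call L)
  ultimately show ?thesis by (simp add: adjoint_circuit_def)
qed

lemma run_copy_label_append:
  assumes L: "realizes L W"
  shows "run ([Plain copy_label] @ L) x *\<^sub>v start_state x
    = kron_vec (W x *\<^sub>v input_state x) (label_state x)"
proof -
  have input: "input_state x \<in> carrier_vec (2 ^ n)" using state_input_state by (simp add: state_def)
  have valid_copy: "valid [Plain copy_label]" using unitary_copy_label by simp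
  have "start_state x \<in> carrier_vec (2 ^ (n + a))"
    using kron_vec_carrier[OF input unit_vec_carrier] by (simp add: power_add)
  then have "run ([Plain copy_label] @ L) x *\<^sub>v start_state x
      = run L x *\<^sub>v kron_vec (input_state x) (label_state x)"
    using run_append_mult_vec[OF valid_copy realizes_valid[OF L]] valid_copy
    by (simp add: run_singleton copy_label_mult_vec)
  then show ?thesis by (simp add: realizes_run[OF L input])
qed

lemma attains_imp_decides_with_certainty:
  assumes P: "projector (2 ^ n) P" and E: "E \<in> outcomes (2 ^ n) P" and "attains E \<Psi> 1 0"
  obtains C' A where "valid C'" "Call \<in> set C'" "Call_adjoint \<in> set C'"
    "A \<in> outcomes (2 ^ (n + a)) (kron_mat P (1\<^sub>m (2 ^ a)))"
    "decides_with_certainty (\<lambda>x. run C' x *\<^sub>v start_state x) X \<Psi> A"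
proof -
  obtain L W where "realizes L W"
    and prob: "\<forall>x\<in>X. outcome_prob E (W x *\<^sub>v input_state x) = (if \<Psi> x then 1 else 0)"
    using assms(3) by (auto simp: attains_def)
  define C' where "C' = [Plain copy_label] @ [Call, Call_adjoint] @ L"
  have L: "realizes ([Call, Call_adjoint] @ L) W"
    using \<open>realizes L W\<close> by (rule realizes_Call_Call_adjoint_append)
  have E_carrier: "E \<in> carrier_mat (2 ^ n) (2 ^ n)"
    using E projector_carrier[OF P] by (auto simp: outcomes_def minus_carrier_mat)
  have "W x *\<^sub>v input_state x \<in> carrier_vec (2 ^ n)" for x
    using state_unitary_mat[OF realizes_unitary[OF L] state_input_state] by (simp add: state_def)
  moreover have "state (2 ^ a) (label_state x)" for x
    using m_less label_less[of x] by (intro orthonormal_state[OF orthonormal_unit_vec]) simp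
  ultimately have
    "decides_with_certainty (\<lambda>x. run C' x *\<^sub>v start_state x) X \<Psi> (kron_mat E (1\<^sub>m (2 ^ a)))"
    unfolding decides_with_certainty_def C'_def run_copy_label_append[OF L]
    using prob by (simp add: outcome_prob_kron_mat_one[OF E_carrier])
  moreover have "kron_mat E (1\<^sub>m (2 ^ a)) \<in> outcomes (2 ^ (n + a)) (kron_mat P (1\<^sub>m (2 ^ a)))"
    using outcomes_kron_mat_one[OF projector_carrier[OF P] E] by (simp only: power_add)
  moreover have "valid C'" using unitary_copy_label realizes_valid[OF L] by (simp add: C'_def)
  ultimately show ?thesis by (intro that[of C']) (auto simp: C'_def)
qed

end

theorem theorem3:
  fixes X :: "'x set" and \<Phi> :: "'x \<Rightarrow> bool" and \<delta> \<epsilon> :: real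
    and n :: nat and s :: "'x input_model" and \<phi> :: "complex vec"
    and C :: "gate list" and P Eg Eb :: "complex mat"
  assumes "\<delta> < \<epsilon>"
    and "valid_input n X s \<phi>"
    and "\<forall>g\<in>set C. valid_gate n s g"
    and "projector (2 ^ n) P"
    and "Eg \<in> outcomes (2 ^ n) P" and "Eb \<in> outcomes (2 ^ n) P"
    and "two_sided_exact_error (circuit_output n s \<phi> C) X \<Phi> Eg Eb \<delta> \<epsilon>"
    and nondegenerate: "Eg \<noteq> Eb \<longrightarrow> \<delta> + \<epsilon> \<noteq> 1"
  shows "\<exists>a C' Q A.
    (\<forall>g\<in>set C'. valid_call_gate (n + a) g) \<and> Call \<in> set C' \<and> Call_adjoint \<in> set C' \<and>
    projector (2 ^ a) Q \<and> A \<in> outcomes (2 ^ (n + a)) (kron_mat P Q) \<and>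
    decides_with_certainty (calling_output n a s \<phi> C C') X \<Phi> A"
proof -
  obtain k \<zeta> label where \<zeta>: "orthonormal (2 ^ n) (2 ^ k) \<zeta>" "\<And>x. label x < 2 ^ k"
    and initial_state_eq: "\<And>x. x \<in> X \<Longrightarrow> initial_state s \<phi> x = \<zeta> (label x)"
    using labelled_initial_states[OF assms(2)] by metis
  interpret calling_circuits n "Suc k" "2 ^ k" X "circuit_mat n s C" \<zeta> label
    using \<zeta> unitary_circuit_mat[OF assms(2,3)] by unfold_locales simp_all
  have out: "circuit_output n s \<phi> C x = circuit_mat n s C x *\<^sub>v input_state x" if "x \<in> X" for x
    using that by (simp add: circuit_output_def initial_state_eq)
  then have state_out: "\<forall>x\<in>X. state (2 ^ n) (circuit_output n s \<phi> C x)"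
    by (simp add: state_unitary_mat[OF unitary_V state_input_state])
  obtain p q where distinct_probs: "p \<noteq> q" "p \<in> {0..1}" "q \<in> {0..1}"
    and "\<forall>x\<in>X. outcome_prob P (circuit_output n s \<phi> C x) = (if \<Phi> x then p else q)"
    using two_sided_error_outcome_probs[OF assms(1,4-6) state_out assms(7) nondegenerate] by blast
  then have "attains P \<Phi> p q" by (intro attains_V) (simp add: out)
  then obtain E where E: "E \<in> outcomes (2 ^ n) P" "attains E \<Phi> 1 0"
    by (rule outcome_attains_1_0[OF assms(4) _ distinct_probs])
  obtain C' A where "valid C'" "Call \<in> set C'" "Call_adjoint \<in> set C'"
    "A \<in> outcomes (2 ^ (n + Suc k)) (kron_mat P (1\<^sub>m (2 ^ Suc k)))"
    "decides_with_certainty (\<lambda>x. run C' x *\<^sub>v start_state x) X \<Phi> A"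
    by (rule attains_imp_decides_with_certainty[OF assms(4) E])
  moreover from this have "decides_with_certainty (calling_output n (Suc k) s \<phi> C C') X \<Phi> A"
    by (simp add: decides_with_certainty_def calling_output_def run_def initial_state_eq)
  ultimately show ?thesis using projector_one by blast
qed

end
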